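(* Let $w\in\tilde S_n$ be 321-avoiding. Then there exist $m\in[0,n]$ and $\mu,\lambda\in\mathcal C^{n,m}$ with $u_w\cdot\mu=\lambda$ and $\tilde F_w=\tilde F^c_{\lambda/\mu}$; that is, $\tilde F_w$ is a cylindric Schur function.
   Context: Fix $n\ge3$; indices mod $n$. $\tilde S_n$ is the affine symmetric group with Coxeter generators $s_0,\dots,s_{n-1}$, length $l$. A reduced word of $w$ is a word $\rho_1\cdots\rho_l$ with $w=s_{\rho_1}\cdots s_{\rho_l}$, $l=l(w)$; $w$ is 321-avoiding if no reduced word of $w$ contains three consecutive letters $i,i+1,i$ (mod $n$). $\mathcal U_n$ is the $\mathbb C$-algebra generated by $u_0,\dots,u_{n-1}$ with $u_i^2=0$, $u_iu_{i+1}u_i=u_{i+1}u_iu_{i+1}$, $u_iu_j=u_ju_i$ for $|i-j|\ge2$; $u_w=u_{\rho_1}\cdots u_{\rho_l}$ for any reduced word. For $A\subsetneq\{0,\dots,n-1\}$, $u_A$ is the product of the $u_a$, $a\in A$, in any order where $u_{i+1}$ precedes $u_i$ whenever $i,i+1\in A$; $h_k(\mathbf u)=\sum_{|A|=k}u_A$. $\tilde F_w$ is the formal power series whose coefficient of $x_1^{a_1}\cdots x_t^{a_t}$ (entries in $[0,n-1]$) is $\langle h_{a_t}(\mathbf u)\cdots h_{a_1}(\mathbf u)\cdot1,w\rangle$, for the action $u_i\cdot v=s_iv$ if $l(s_iv)>l(v)$, else $0$, on $\mathbb C[\tilde S_n]$ with orthonormal basis $\tilde S_n$. For $m\in[0,n]$,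 $\mathcal C^{n,m}$ is the set of sequences $p=(p_j)_{j\in\mathbb Z}\in\{0,1\}^{\mathbb Z}$ with $p_{j+n}=p_j$ for all $j$ and $p_1+\cdots+p_n=m$ (these encode cylindric shapes). $s_i$ acts on $p$ by exchanging $p_{i+kn}$ and $p_{i+1+kn}$ for all $k\in\mathbb Z$, and $\mathcal U_n$ acts on $\mathbb C[\mathcal C^{n,m}]$ by $u_i\cdot p=s_i\cdot p$ if $(p_i,p_{i+1})=(1,0)$ (adding boxes) and $u_i\cdot p=0$ otherwise; $\langle p,q\rangle=\delta_{pq}$. For $\mu,\lambda\in\mathcal C^{n,m}$, $\tilde F^c_{\lambda/\mu}$ is the formal power series whose coefficient of $x_1^{a_1}\cdots x_t^{a_t}$ (entries in $[0,n-1]$) is $\langle h_{a_t}(\mathbf u)\cdots h_{a_1}(\mathbf u)\cdot\mu,\lambda\rangle$; these are the cylindric Schur functions.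
   Formalization: A cylindric shape is taken as a 0-1 sequence p together with an integer position that u_0 raises by 1; for bare sequences the claim fails, e.g. n=3, w=s_2s_1s_0 forces λ=μ, so the constant terms of the two series are 0 and 1. *)

theory Defs
  imports Complex_Main "HOL-Library.Poly_Mapping"
begin

section \<open>The affine symmetric group\<close>

text \<open>The affine symmetric group is realised as the group, under composition, of affine
  permutations of the integers. Generators are indexed by the naturals below \<open>n\<close>,
  and index arithmetic is modulo \<open>n\<close>.\<close>

definition affine_sym :: "nat \<Rightarrow> (int \<Rightarrow> int) set" where
  "affine_sym n = {w. bij w \<and> (\<forall>j. w (j + int n) = w j + int n) \<and>
                      (\<Sum>j = 1..int n. w j) = (\<Sum>j = 1..int n. j)}"

definition cox_gen :: "nat \<Rightarrow> nat \<Rightarrow> int \<Rightarrow> int" where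
  "cox_gen n i j =
     (if j mod int n = int i mod int n then j + 1
      else if j mod int n = (int i + 1) mod int n then j - 1
      else j)"

definition word_prod :: "nat \<Rightarrow> nat list \<Rightarrow> int \<Rightarrow> int" where
  "word_prod n \<rho> = foldr (\<lambda>i v. cox_gen n i \<circ> v) \<rho> id"

definition cox_length :: "nat \<Rightarrow> (int \<Rightarrow> int) \<Rightarrow> nat" where
  "cox_length n w = (LEAST l. \<exists>\<rho> \<in> lists {..<n}. length \<rho> = l \<and> word_prod n \<rho> = w)"

definition reduced_word :: "nat \<Rightarrow> (int \<Rightarrow> int) \<Rightarrow> nat list \<Rightarrow> bool" where
  "reduced_word n w \<rho> \<longleftrightarrow>
     \<rho> \<in> lists {..<n} \<and> word_prod n \<rho> = w \<and> length \<rho> = cox_length n w"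

definition avoids_321 :: "nat \<Rightarrow> (int \<Rightarrow> int) \<Rightarrow> bool" where
  "avoids_321 n w \<longleftrightarrow>
     (\<forall>\<rho>. reduced_word n w \<rho> \<longrightarrow>
        \<not> (\<exists>xs i ys. \<rho> = xs @ [i, (i + 1) mod n, i] @ ys))"


section \<open>Complex vector spaces with an orthonormal basis\<close>

text \<open>\<open>'b \<Rightarrow>\<^sub>0 complex\<close> is the space of finite formal complex combinations of
  elements of \<open>'b\<close>.\<close>

definition basis_vec :: "'b \<Rightarrow> 'b \<Rightarrow>\<^sub>0 complex" where
  "basis_vec x = Poly_Mapping.single x 1"

definition scale_vec :: "complex \<Rightarrow> ('b \<Rightarrow>\<^sub>0 complex) \<Rightarrow> 'b \<Rightarrow>\<^sub>0 complex" where
  "scale_vec c \<phi> = Poly_Mapping.map (\<lambda>z. c * z) \<phi>"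

definition lin_ext ::
    "('b \<Rightarrow> 'b \<Rightarrow>\<^sub>0 complex) \<Rightarrow> ('b \<Rightarrow>\<^sub>0 complex) \<Rightarrow> 'b \<Rightarrow>\<^sub>0 complex" where
  "lin_ext f \<phi> = (\<Sum>x \<in> Poly_Mapping.keys \<phi>. scale_vec (Poly_Mapping.lookup \<phi> x) (f x))"

definition inner_vec :: "('b \<Rightarrow>\<^sub>0 complex) \<Rightarrow> ('b \<Rightarrow>\<^sub>0 complex) \<Rightarrow> complex" where
  "inner_vec \<phi> \<psi> =
     (\<Sum>x \<in> Poly_Mapping.keys \<phi>. Poly_Mapping.lookup \<phi> x * cnj (Poly_Mapping.lookup \<psi> x))"


section \<open>Elements of the nilCoxeter algebra acting on a module\<close>

text \<open>Elements of \<open>\<U>\<^sub>n\<close> only occur through their action on a module. A module is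
  given by the values \<open>act i x\<close> of the generator \<open>u\<^sub>i\<close> on basis vectors \<open>x\<close>, and
  an element is evaluated as the corresponding operator. Words act with their rightmost
  letter first.\<close>

definition word_op ::
    "(nat \<Rightarrow> 'b \<Rightarrow> 'b \<Rightarrow>\<^sub>0 complex) \<Rightarrow> nat list \<Rightarrow> ('b \<Rightarrow>\<^sub>0 complex) \<Rightarrow> 'b \<Rightarrow>\<^sub>0 complex" where
  "word_op act \<rho> = foldr (\<lambda>i F. lin_ext (act i) \<circ> F) \<rho> id"

text \<open>By the relations of \<open>\<U>\<^sub>n\<close>, neither \<open>u\<^sub>w\<close> nor \<open>u\<^sub>A\<close> depends on the word
  selected by \<open>SOME\<close>.\<close>

definition u_elt ::
    "nat \<Rightarrow> (nat \<Rightarrow> 'b \<Rightarrow> 'b \<Rightarrow>\<^sub>0 complex) \<Rightarrow> (int \<Rightarrow> int) \<Rightarrow> ('b \<Rightarrow>\<^sub>0 complex) \<Rightarrow> 'b \<Rightarrow>\<^sub>0 complex" where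
  "u_elt n act w = word_op act (SOME \<rho>. reduced_word n w \<rho>)"

definition cyc_decreasing_word :: "nat \<Rightarrow> nat set \<Rightarrow> nat list \<Rightarrow> bool" where
  "cyc_decreasing_word n A \<rho> \<longleftrightarrow>
     distinct \<rho> \<and> set \<rho> = A \<and>
     (\<forall>i \<in> A. (i + 1) mod n \<in> A \<longrightarrow>
        (\<exists>xs ys zs. \<rho> = xs @ [(i + 1) mod n] @ ys @ [i] @ zs))"

definition u_set ::
    "nat \<Rightarrow> (nat \<Rightarrow> 'b \<Rightarrow> 'b \<Rightarrow>\<^sub>0 complex) \<Rightarrow> nat set \<Rightarrow> ('b \<Rightarrow>\<^sub>0 complex) \<Rightarrow> 'b \<Rightarrow>\<^sub>0 complex" where
  "u_set n act A = word_op act (SOME \<rho>. cyc_decreasing_word n A \<rho>)"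

text \<open>The sum is over proper subsets, so \<open>h_op n act k\<close> vanishes for \<open>k \<ge> n\<close>.\<close>

definition h_op ::
    "nat \<Rightarrow> (nat \<Rightarrow> 'b \<Rightarrow> 'b \<Rightarrow>\<^sub>0 complex) \<Rightarrow> nat \<Rightarrow> ('b \<Rightarrow>\<^sub>0 complex) \<Rightarrow> 'b \<Rightarrow>\<^sub>0 complex" where
  "h_op n act k \<phi> = (\<Sum>A | A \<subset> {..<n} \<and> card A = k. u_set n act A \<phi>)"

text \<open>A formal power series in infinitely many variables is given by its coefficient function
  on monomials; the monomial with exponents \<open>a\<close> is the product of
  \<open>x\<^sub>j\<close> to the power \<open>lookup a (j - 1)\<close> over \<open>j \<ge> 1\<close>. The number
  \<open>Poly_Mapping.degree a\<close> is the least \<open>t\<close> such that only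
  \<open>x\<^sub>1, \<dots>, x\<^sub>t\<close> occur. Exponents \<open>\<ge> n\<close> give coefficient 0.\<close>

type_synonym power_series = "(nat \<Rightarrow>\<^sub>0 nat) \<Rightarrow> complex"

definition h_series ::
    "nat \<Rightarrow> (nat \<Rightarrow> 'b \<Rightarrow> 'b \<Rightarrow>\<^sub>0 complex) \<Rightarrow> 'b \<Rightarrow> 'b \<Rightarrow> power_series" where
  "h_series n act x y a =
     inner_vec (fold (h_op n act) (map (Poly_Mapping.lookup a) [0..<Poly_Mapping.degree a])
                  (basis_vec x))
       (basis_vec y)"


section \<open>Affine Stanley symmetric functions\<close>

definition affine_act :: "nat \<Rightarrow> nat \<Rightarrow> (int \<Rightarrow> int) \<Rightarrow> (int \<Rightarrow> int) \<Rightarrow>\<^sub>0 complex" where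
  "affine_act n i v =
     (if cox_length n (cox_gen n i \<circ> v) > cox_length n v
      then basis_vec (cox_gen n i \<circ> v) else 0)"

definition affine_stanley :: "nat \<Rightarrow> (int \<Rightarrow> int) \<Rightarrow> power_series" where
  "affine_stanley n w = h_series n (affine_act n) id w"


section \<open>Cylindric Schur functions\<close>

definition edge_seqs :: "nat \<Rightarrow> nat \<Rightarrow> (int \<Rightarrow> nat) set" where
  "edge_seqs n m = {p. (\<forall>j. p j \<in> {0, 1}) \<and> (\<forall>j. p (j + int n) = p j) \<and>
                       (\<Sum>j = 1..int n. p j) = m}"

text \<open>A cylindric shape is a periodic lattice path in the plane. Its steps are encoded by a
  periodic 0-1 sequence \<open>p\<close>, but \<open>p\<close> determines the path only up to translation
  along the main diagonal: adding one box on every diagonal shifts the path and leaves \<open>p\<close>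
  unchanged, although the shape has grown. A shape is therefore a pair \<open>(p, r)\<close>, where
  \<open>r\<close> is the position, along its diagonal, of the vertex of the path between the edges
  \<open>p\<^sub>0\<close> and \<open>p\<^sub>1\<close>.\<close>

type_synonym cyl_shape = "(int \<Rightarrow> nat) \<times> int"

definition cyl_shapes :: "nat \<Rightarrow> nat \<Rightarrow> cyl_shape set" where
  "cyl_shapes n m = edge_seqs n m \<times> UNIV"

text \<open>The generator \<open>u\<^sub>i\<close> adds the boxes on the diagonals congruent to \<open>i\<close> modulo
  \<open>n\<close>, which moves the vertices of the path between \<open>p\<^sub>j\<close> and \<open>p\<^sub>j\<^sub>+\<^sub>1\<close> for
  \<open>j\<close> congruent to \<open>i\<close>; the vertex recorded by \<open>r\<close> is moved by \<open>u\<^sub>0\<close> only.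
  Precomposing \<open>p\<close> with \<open>cox_gen n i\<close> exchanges those entries.\<close>

definition cyl_act :: "nat \<Rightarrow> nat \<Rightarrow> cyl_shape \<Rightarrow> cyl_shape \<Rightarrow>\<^sub>0 complex" where
  "cyl_act n i \<nu> =
     (let (p, r) = \<nu> in
        if p (int i) = 1 \<and> p (int i + 1) = 0
        then basis_vec (p \<circ> cox_gen n i, if i = 0 then r + 1 else r) else 0)"

text \<open>The series of the skew shape \<open>\<kappa>/\<mu>\<close>.\<close>

definition cyl_schur :: "nat \<Rightarrow> cyl_shape \<Rightarrow> cyl_shape \<Rightarrow> power_series" where
  "cyl_schur n \<kappa> \<mu> = h_series n (cyl_act n) \<mu> \<kappa>"

end

theory Submission
  imports Defs "HOL-Library.Multiset"
begin

text \<open>Let \<open>p\<close> be the indicator sequence of the left ends of inversions of \<open>w\<close>. Since \<open>w\<close>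
  has no 321 pattern, the right end of an inversion is never a left end, so each letter of a reduced
  word of \<open>w\<close> exchanges a 1 with a 0 to its right: every reduced word carries \<open>p\<close> to
  \<open>p \<circ> w\<^sup>-\<^sup>1\<close>. Conversely, the end points of a word that acts on \<open>p\<close> without
  annihilating it determine how often each letter occurs, and two such words with the same letters
  agree up to commutations. So the words carrying \<open>\<mu>\<close> to \<open>\<kappa>\<close> are exactly the reduced
  words of \<open>w\<close>, and the two series agree word by word.\<close>

text \<open>The hypothesis \<open>avoids_321\<close> speaks of reduced words, whereas the choice of
  \<open>p\<close> needs a statement about values of \<open>w\<close>. The bridge is that a
  decreasing triple of values forces some reduced word with a factor i, i+1, i.

  Generators multiply on the left. This exchanges two values of a permutation, hence two adjacent
  positions of its inverse, and positions are far easier to follow. Inversions are therefore counted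
  on the inverse \<open>word_prod n (rev \<rho>)\<close>, which is also the map that transports edge
  sequences.

  The end state of a legal word fixes the letter multiplicities only up to one common constant,
  because adding a box on every diagonal returns the same sequence. The second coordinate of a shape
  counts the letter 0 and so fixes that constant; for two reduced words of \<open>w\<close> their
  common length does.\<close>

lemma sum_periodic_window:
  fixes f :: "int \<Rightarrow> 'a::comm_monoid_add" and n :: nat
  assumes "n > 0" and per: "\<And>j. f (j + int n) = f j"
  shows "sum f {a..<a + int n} = sum f {b..<b + int n}"
proof -
  have per': "f (j + int n * k) = f j" for j k
  proof (induction k)
    case (nonneg k)
    then show ?case
    proof (induction k)
      case (Suc k)
      have "f (j + int n * int (Suc k)) = f ((j + int n * int k) + int n)"
        by (simp add: algebra_simps)
      then show ?case using Suc per by simp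
    qed simp
  next
    case (neg k)
    have *: "f (j - int n * int k) = f j" for k
    proof (induction k)
      case (Suc k)
      have "f (j - int n * int k) = f ((j - int n * int (Suc k)) + int n)"
        by (simp add: algebra_simps)
      then show ?case using Suc per by simp
    qed simp
    show ?case using *[of "Suc k"] by (simp add: algebra_simps)
  qed
  have mod: "f (c + (j - c) mod int n) = f j" for c j
    using per'[of "c + (j - c) mod int n" "(j - c) div int n"]
    by (simp add: algebra_simps)
  have eq: "c + ((d + (j - d) mod int n) - c) mod int n = j"
    if "j \<in> {c..<c + int n}" for c d j
  proof -
    have "((d + (j - d) mod int n) - c) mod int n = (d - c + (j - d) mod int n) mod int n"
      by (simp add: algebra_simps)
    also have "\<dots> = (j - c) mod int n"
      by (simp add: mod_simps)
    finally show ?thesis using that by simp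
  qed
  \<comment> \<open>Each window is a complete residue system, so every index is sent to its
    representative in the other window.\<close>
  show ?thesis
    by (rule sum.reindex_bij_witness[where i = "\<lambda>j. a + (j - a) mod int n"
          and j = "\<lambda>j. b + (j - b) mod int n"])
       (use \<open>n > 0\<close> in \<open>simp_all add: eq mod\<close>)
qed

section \<open>Words acting on modules\<close>

lemma lookup_scale_vec [simp]: "Poly_Mapping.lookup (scale_vec c \<phi>) x = c * Poly_Mapping.lookup \<phi> x"
  by (simp add: scale_vec_def map.rep_eq when_def)

lemma lookup_basis_vec: "Poly_Mapping.lookup (basis_vec x) y = (if x = y then 1 else 0)"
  by (simp add: basis_vec_def lookup_single when_def)

lemma keys_basis_vec [simp]: "Poly_Mapping.keys (basis_vec x) = {x}"
  by (simp add: basis_vec_def)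

lemma lin_ext_superset:
  assumes "finite X" "Poly_Mapping.keys \<phi> \<subseteq> X"
  shows "lin_ext f \<phi> = (\<Sum>x\<in>X. scale_vec (Poly_Mapping.lookup \<phi> x) (f x))"
  unfolding lin_ext_def
  by (rule sum.mono_neutral_left) (use assms in \<open>auto intro!: poly_mapping_eqI simp: in_keys_iff\<close>)

lemma lin_ext_zero [simp]: "lin_ext f 0 = 0"
  by (simp add: lin_ext_def)

lemma lin_ext_add: "lin_ext f (\<phi> + \<psi>) = lin_ext f \<phi> + lin_ext f \<psi>"
proof -
  let ?X = "Poly_Mapping.keys \<phi> \<union> Poly_Mapping.keys \<psi>"
  have "scale_vec (Poly_Mapping.lookup (\<phi> + \<psi>) x) (f x)
      = scale_vec (Poly_Mapping.lookup \<phi> x) (f x) + scale_vec (Poly_Mapping.lookup \<psi> x) (f x)" for x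
    by (rule poly_mapping_eqI) (simp add: lookup_add algebra_simps)
  then show ?thesis
    using Poly_Mapping.keys_add[of \<phi> \<psi>]
    by (simp add: lin_ext_superset[of ?X] sum.distrib)
qed

lemma lin_ext_basis_vec [simp]: "lin_ext f (basis_vec x) = f x"
  by (rule poly_mapping_eqI) (simp add: lin_ext_def lookup_basis_vec)

lemma word_op_simps [simp]:
  "word_op act [] \<phi> = \<phi>"
  "word_op act (i # \<rho>) \<phi> = lin_ext (act i) (word_op act \<rho> \<phi>)"
  by (simp_all add: word_op_def)

lemma word_op_append: "word_op act (\<rho> @ \<sigma>) \<phi> = word_op act \<rho> (word_op act \<sigma> \<phi>)"
  by (induction \<rho>) auto

lemma word_op_zero: "word_op act \<rho> 0 = 0"
  by (induction \<rho>) auto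

lemma word_op_add: "word_op act \<rho> (\<phi> + \<psi>) = word_op act \<rho> \<phi> + word_op act \<rho> \<psi>"
  by (induction \<rho>) (auto simp: lin_ext_add)

lemma word_op_sum: "word_op act \<rho> (\<Sum>a\<in>S. f a) = (\<Sum>a\<in>S. word_op act \<rho> (f a))"
  by (induction S rule: infinite_finite_induct) (auto simp: word_op_zero word_op_add)

lemma inner_vec_basis_vec: "inner_vec \<phi> (basis_vec y) = Poly_Mapping.lookup \<phi> y"
proof -
  have "inner_vec \<phi> (basis_vec y) = (\<Sum>x\<in>Poly_Mapping.keys \<phi>. if x = y then Poly_Mapping.lookup \<phi> x else 0)"
    unfolding inner_vec_def by (rule sum.cong) (auto simp: lookup_basis_vec)
  then show ?thesis by (simp add: in_keys_iff)
qed

text \<open>The words occurring in \<open>h\<^sub>k\<^sub>t \<cdots> h\<^sub>k\<^sub>1\<close>, for \<open>ks = [k\<^sub>1, \<dots>, k\<^sub>t]\<close>; they are the same for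
  every module.\<close>

primrec h_words :: "nat \<Rightarrow> nat list \<Rightarrow> nat list multiset" where
  "h_words n [] = {#[]#}"
| "h_words n (k # ks) = (\<Sum>A | A \<subset> {..<n} \<and> card A = k.
     image_mset (\<lambda>\<rho>. \<rho> @ (SOME \<rho>. cyc_decreasing_word n A \<rho>)) (h_words n ks))"

lemma sum_mset_image_sum:
  "(\<Sum>x\<in>#(\<Sum>a\<in>S. M a). f x) = (\<Sum>a\<in>S. \<Sum>x\<in>#M a. f x)"
  by (induction S rule: infinite_finite_induct) auto

lemma sum_mset_sum_swap: "(\<Sum>x\<in>#M. \<Sum>a\<in>S. f x a) = (\<Sum>a\<in>S. \<Sum>x\<in>#M. f x a)"
  by (induction M) (auto simp: sum.distrib)

lemma lookup_sum_mset: "Poly_Mapping.lookup (\<Sum>x\<in>#M. f x) y = (\<Sum>x\<in>#M. Poly_Mapping.lookup (f x) y)"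
  by (induction M) (auto simp: lookup_add)

text \<open>\<open>fold\<close> applies the head of \<open>ks\<close> first, and words act from the
  right; this is why the word for the head stands at the right end in
  \<open>h_words\<close>.\<close>

lemma fold_h_op: "fold (h_op n act) ks \<phi> = (\<Sum>\<rho>\<in>#h_words n ks. word_op act \<rho> \<phi>)"
proof (induction ks arbitrary: \<phi>)
  case (Cons k ks)
  let ?S = "{A. A \<subset> {..<n} \<and> card A = k}"
  let ?W = "\<lambda>A. SOME \<rho>. cyc_decreasing_word n A \<rho>"
  have "fold (h_op n act) (k # ks) \<phi>
      = (\<Sum>\<rho>\<in>#h_words n ks. \<Sum>A\<in>?S. word_op act (\<rho> @ ?W A) \<phi>)"
    by (simp add: Cons.IH h_op_def u_set_def word_op_sum word_op_append)
  also have "\<dots> = (\<Sum>\<rho>\<in>#h_words n (k # ks). word_op act \<rho> \<phi>)"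
    by (simp add: sum_mset_sum_swap sum_mset_image_sum image_mset.compositionality comp_def)
  finally show ?case .
qed simp

lemma h_series_eq_sum_words:
  "h_series n act x y a =
    (\<Sum>\<rho>\<in>#h_words n (map (Poly_Mapping.lookup a) [0..<Poly_Mapping.degree a]). Poly_Mapping.lookup (word_op act \<rho> (basis_vec x)) y)"
  by (simp add: h_series_def inner_vec_basis_vec fold_h_op lookup_sum_mset)

section \<open>Affine permutations\<close>

lemma word_prod_simps [simp]:
  "word_prod n [] = id"
  "word_prod n (i # \<rho>) = cox_gen n i \<circ> word_prod n \<rho>"
  by (simp_all add: word_prod_def)

lemma word_prod_append [simp]: "word_prod n (\<rho> @ \<sigma>) = word_prod n \<rho> \<circ> word_prod n \<sigma>"
  by (induction \<rho>) auto

text \<open>The affine inversion number. Inversions come in classes under translating both entries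
  by \<open>n\<close>; each class is counted once, through its member whose left end lies in the
  window, while the right end is unrestricted.\<close>

definition inv_count :: "nat \<Rightarrow> (int \<Rightarrow> int) \<Rightarrow> nat" where
  "inv_count n u = (\<Sum>a = 0..<int n. card {b. a < b \<and> u b < u a})"

definition inversion_start :: "(int \<Rightarrow> int) \<Rightarrow> int \<Rightarrow> nat" where
  "inversion_start w a = of_bool (\<exists>b > a. w b < w a)"

context
  fixes n :: nat
  assumes n3: "3 \<le> n"
begin

lemma mod_add_small_neq:
  fixes j d :: int
  assumes "0 < d" "d < int n"
  shows "(j + d) mod int n \<noteq> j mod int n"
proof
  assume "(j + d) mod int n = j mod int n"
  then have "int n dvd d"
    by (simp add: mod_eq_dvd_iff)
  with assms show False
    by (auto dest: zdvd_imp_le)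
qed

lemma mod_succ_cancel: "(j + 1) mod int n = (k + 1) mod int n \<longleftrightarrow> j mod int n = k mod int n"
  by (simp add: mod_eq_dvd_iff)

lemma cox_gen_at: "j mod int n = int i mod int n \<Longrightarrow> cox_gen n i j = j + 1"
  by (simp add: cox_gen_def)

lemma cox_gen_succ: "j mod int n = int i mod int n \<Longrightarrow> cox_gen n i (j + 1) = j"
  using mod_add_small_neq[of 1 j] n3 mod_succ_cancel[of j "int i"]
  by (auto simp: cox_gen_def)

lemma cox_gen_other:
  "\<lbrakk>j mod int n \<noteq> int i mod int n; (j - 1) mod int n \<noteq> int i mod int n\<rbrakk> \<Longrightarrow> cox_gen n i j = j"
  using mod_succ_cancel[of "j - 1" "int i"] by (simp add: cox_gen_def)

lemma cox_gen_cases [case_names at succ other]: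
  obtains "j mod int n = int i mod int n" "cox_gen n i j = j + 1"
  | "(j - 1) mod int n = int i mod int n" "cox_gen n i j = j - 1"
  | "j mod int n \<noteq> int i mod int n" "(j - 1) mod int n \<noteq> int i mod int n" "cox_gen n i j = j"
  using cox_gen_at cox_gen_other cox_gen_succ[of "j - 1"] by force

lemma cox_gen_invol [simp]: "cox_gen n i (cox_gen n i j) = j"
  by (cases i j rule: cox_gen_cases) (simp_all add: cox_gen_at cox_gen_succ[of "j - 1", simplified]
      cox_gen_succ)

lemma cox_gen_comp_invol [simp]: "cox_gen n i \<circ> cox_gen n i = id"
  by auto

lemma cox_gen_eq_iff [simp]: "cox_gen n i j = cox_gen n i k \<longleftrightarrow> j = k"
  by (metis cox_gen_invol)

lemma bij_cox_gen: "bij (cox_gen n i)"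
  by (rule o_bij[of "cox_gen n i"]) simp_all

lemma cox_gen_shift: "cox_gen n i (j + int n) = cox_gen n i j + int n"
  by (simp add: cox_gen_def)

text \<open>Points move by at most one, so only pairs at distance one or two are in danger. At
  distance two they would have to meet, which the residues forbid; at distance one injectivity
  leaves only the excluded pair.\<close>

lemma cox_gen_less:
  assumes "a < b" and "\<not> (a mod int n = int i mod int n \<and> b = a + 1)"
  shows "cox_gen n i a < cox_gen n i b"
proof (rule ccontr)
  assume neg: "\<not> cox_gen n i a < cox_gen n i b"
  have *: "b = a + 2 \<Longrightarrow> a mod int n = int i mod int n \<Longrightarrow>
      (b - 1) mod int n = int i mod int n \<Longrightarrow> False"
    using mod_add_small_neq[of 1 a] n3 by (auto simp: add.commute)
  from neg assms * cox_gen_eq_iff[of i a b] show False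
    by (cases i a rule: cox_gen_cases; cases i b rule: cox_gen_cases) auto
qed

lemma cox_gen_commute:
  assumes "(int i) mod int n \<noteq> int j mod int n" "(int i + 1) mod int n \<noteq> int j mod int n"
    "(int j + 1) mod int n \<noteq> int i mod int n"
  shows "cox_gen n i \<circ> cox_gen n j = cox_gen n j \<circ> cox_gen n i"
proof
  have fix_gen: "cox_gen n q k = k \<and> cox_gen n q (cox_gen n p k) = cox_gen n p k"
    if "int p mod int n \<noteq> int q mod int n" "(int p + 1) mod int n \<noteq> int q mod int n"
      "(int q + 1) mod int n \<noteq> int p mod int n" "cox_gen n p k \<noteq> k" for p q k
  proof (cases p k rule: cox_gen_cases)
    case at
    have "(k - 1) mod int n \<noteq> int q mod int n"
      using at that mod_succ_cancel[of "k - 1" "int q"] by auto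
    moreover have "(k + 1) mod int n \<noteq> int q mod int n"
      using at that mod_succ_cancel[of k "int p"] by auto
    ultimately show ?thesis
      using at that by (auto intro!: cox_gen_other)
  next
    case succ
    have "(k - 1 - 1) mod int n \<noteq> int q mod int n"
      using succ that mod_succ_cancel[of "k - 1 - 1" "int q"] by auto
    moreover have "k mod int n \<noteq> int q mod int n"
      using succ that mod_succ_cancel[of "k - 1" "int p"] by auto
    ultimately show ?thesis
      using succ that by (auto intro!: cox_gen_other)
  qed (use that in auto)
  fix k
  show "(cox_gen n i \<circ> cox_gen n j) k = (cox_gen n j \<circ> cox_gen n i) k"
    using fix_gen[of i j k] fix_gen[of j i k] assms by force
qed

text \<open>The generator permutes the window that starts at \<open>int i\<close>, since it
  exchanges the first two entries there. Other windows may be cut between the two exchanged entries,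
  so the sum is first moved to this one.\<close>

lemma sum_cox_gen:
  fixes f :: "int \<Rightarrow> 'a::comm_monoid_add"
  assumes per: "\<And>j. f (j + int n) = f j"
  shows "(\<Sum>j = a..<a + int n. f (cox_gen n i j)) = (\<Sum>j = a..<a + int n. f j)"
proof -
  let ?W = "{int i..<int i + int n}"
  have mem: "cox_gen n i j \<in> ?W" if "j \<in> ?W" for j
  proof (cases i j rule: cox_gen_cases)
    case at
    have "j = int i"
    proof (rule ccontr)
      assume "j \<noteq> int i"
      then show False using that at mod_add_small_neq[of "j - int i" "int i"] by auto
    qed
    then show ?thesis using at n3 by auto
  next
    case succ
    have "j \<noteq> int i"
      using succ mod_add_small_neq[of 1 "int i - 1"] n3 by auto
    then show ?thesis using succ that by auto
  qed (use that in auto)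
  have "(\<Sum>j \<in> ?W. f (cox_gen n i j)) = sum f ?W"
    by (rule sum.reindex_bij_witness[where i = "cox_gen n i" and j = "cox_gen n i"])
       (use mem in auto)
  moreover have "(\<Sum>j = a..<a + int n. f (cox_gen n i j)) = (\<Sum>j \<in> ?W. f (cox_gen n i j))"
    using n3 by (intro sum_periodic_window) (auto simp: cox_gen_shift per)
  moreover have "sum f {a..<a + int n} = sum f ?W"
    using n3 per by (intro sum_periodic_window) auto
  ultimately show ?thesis by simp
qed

section \<open>Affine permutations and right multiplication by generators\<close>

lemma affine_sym_bij: "u \<in> affine_sym n \<Longrightarrow> bij u"
  by (simp add: affine_sym_def)

lemma affine_sym_inj: "u \<in> affine_sym n \<Longrightarrow> u a = u b \<longleftrightarrow> a = b"
  using affine_sym_bij bij_is_inj inj_eq by metis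

lemma affine_sym_shift: "u \<in> affine_sym n \<Longrightarrow> u (j + int n) = u j + int n"
  by (simp add: affine_sym_def)

lemma affine_sym_shift_mult:
  assumes "u \<in> affine_sym n"
  shows "u (j + int n * k) = u j + int n * k"
proof (induction k rule: int_induct[where k = 0])
  case (step1 k)
  then show ?case
    using affine_sym_shift[OF assms, of "j + int n * k"] by (simp add: algebra_simps)
next
  case (step2 k)
  then show ?case
    using affine_sym_shift[OF assms, of "j + int n * (k - 1)"] by (simp add: algebra_simps)
qed simp

lemma affine_sym_mod:
  assumes "u \<in> affine_sym n" "j mod int n = k mod int n"
  shows "u j = u k + (j - k)"
proof -
  obtain q where "j - k = int n * q"
    using assms(2) by (auto simp: mod_eq_dvd_iff)
  then show ?thesis
    using affine_sym_shift_mult[OF assms(1), of k q] by (simp add: algebra_simps)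
qed

lemma id_affine_sym [simp]: "id \<in> affine_sym n"
  by (simp add: affine_sym_def)

text \<open>Only the normalisation of the sum takes work. The values \<open>u j\<close> are not
  periodic but the displacements \<open>u j - j\<close> are, so the sum is handled through
  displacements.\<close>

lemma affine_sym_comp_cox_gen [simp]:
  assumes u: "u \<in> affine_sym n"
  shows "u \<circ> cox_gen n i \<in> affine_sym n"
proof -
  have W: "{1..int n} = {1..<1 + int n}" by auto
  have "(\<Sum>j = 1..int n. u (cox_gen n i j) - cox_gen n i j) = (\<Sum>j = 1..int n. u j - j)"
    unfolding W
    by (rule sum_cox_gen[where f = "\<lambda>j. u j - j"]) (simp add: affine_sym_shift[OF u])
  moreover have "(\<Sum>j = 1..int n. cox_gen n i j - j) = 0"
  proof -
    \<comment> \<open>Substituting the involution into its own displacement changes the sign, so the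
      sum equals its negative.\<close>
    have "(\<Sum>j = 1..int n. cox_gen n i j - j)
        = (\<Sum>j = 1..int n. cox_gen n i (cox_gen n i j) - cox_gen n i j)"
      unfolding W
      by (rule sum_cox_gen[where f = "\<lambda>j. cox_gen n i j - j", symmetric]) (simp add: cox_gen_shift)
    then show ?thesis by (simp add: sum_subtractf)
  qed
  ultimately have "(\<Sum>j = 1..int n. u (cox_gen n i j)) = (\<Sum>j = 1..int n. j)"
    using u by (simp add: affine_sym_def sum_subtractf)
  then show ?thesis
    using u bij_comp[OF bij_cox_gen affine_sym_bij[OF u]]
    by (simp add: affine_sym_def cox_gen_shift)
qed

lemma word_prod_affine_sym [simp]: "word_prod n \<rho> \<in> affine_sym n"
  by (induction \<rho> rule: rev_induct) (simp_all del: o_apply id_apply)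

lemma word_prod_rev [simp]:
  "word_prod n \<rho> (word_prod n (rev \<rho>) j) = j"
  "word_prod n (rev \<rho>) (word_prod n \<rho> j) = j"
proof -
  show *: "word_prod n \<rho> (word_prod n (rev \<rho>) j) = j" for \<rho> :: "nat list" and j
    by (induction \<rho> arbitrary: j) auto
  show "word_prod n (rev \<rho>) (word_prod n \<rho> j) = j"
    using *[of "rev \<rho>"] by simp
qed

lemma word_prod_rev_eq_iff:
  "word_prod n (rev \<rho>) = word_prod n (rev \<sigma>) \<longleftrightarrow> word_prod n \<rho> = word_prod n \<sigma>"
proof
  assume eq: "word_prod n (rev \<rho>) = word_prod n (rev \<sigma>)"
  show "word_prod n \<rho> = word_prod n \<sigma>"
    by (rule ext) (metis eq word_prod_rev)
next
  assume eq: "word_prod n \<rho> = word_prod n \<sigma>"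
  show "word_prod n (rev \<rho>) = word_prod n (rev \<sigma>)"
    by (rule ext) (metis eq word_prod_rev)
qed


section \<open>Length and inversions\<close>

lemma finite_inversions:
  assumes u: "u \<in> affine_sym n"
  shows "finite {b. a < b \<and> u b < u a}"
proof -
  \<comment> \<open>The displacement \<open>u b - b\<close> has period \<open>n\<close>, so its
    minimum over one window is a global lower bound.\<close>
  define K where "K = Min ((\<lambda>j. u j - j) ` {0..<int n})"
  have K: "K \<le> u b - b" for b
  proof -
    have "u b - b = u (b mod int n) - b mod int n"
      using affine_sym_mod[OF u, of b "b mod int n"] by simp
    also have "\<dots> \<ge> K"
      unfolding K_def using n3 by (intro Min_le) auto
    finally show ?thesis .
  qed
  have "b \<le> u a - K" if "u b < u a" for b
    using K[of b] that by simp
  then have "{b. a < b \<and> u b < u a} \<subseteq> {a..u a - K}"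
    by auto
  then show ?thesis
    by (rule finite_subset) simp
qed

lemma card_inversions_shift:
  assumes u: "u \<in> affine_sym n"
  shows "card {b. a + int n < b \<and> u b < u (a + int n)} = card {b. a < b \<and> u b < u a}"
proof -
  have "bij_betw (\<lambda>b. b + int n) {b. a < b \<and> u b < u a} {b. a + int n < b \<and> u b < u (a + int n)}"
  proof (rule bij_betw_byWitness[where f' = "\<lambda>b. b - int n"])
    show "(\<lambda>b. b - int n) ` {b. a + int n < b \<and> u b < u (a + int n)} \<subseteq> {b. a < b \<and> u b < u a}"
    proof clarify
      fix b
      assume "a + int n < b" "u b < u (a + int n)"
      then show "a < b - int n \<and> u (b - int n) < u a"
        using affine_sym_shift[OF u, of "b - int n"] affine_sym_shift[OF u, of a] by simp
    qed
  qed (auto simp: affine_sym_shift[OF u])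
  then show ?thesis by (simp add: bij_betw_same_card)
qed

text \<open>With the window starting at \<open>int i\<close>, the rows of \<open>int i\<close> and
  \<open>int i + 1\<close> are exchanged, and the one arriving at \<open>int i\<close> gains the new
  inversion with \<open>int i + 1\<close>. In every other row the right ends are merely
  permuted.\<close>

lemma inv_count_ascent:
  assumes u: "u \<in> affine_sym n" and asc: "u (int i) < u (int i + 1)"
  shows "inv_count n (u \<circ> cox_gen n i) = inv_count n u + 1"
proof -
  let ?s = "cox_gen n i" and ?u = "u \<circ> cox_gen n i" and ?i = "int i"
  let ?c = "\<lambda>v a. card {b. a < b \<and> (v :: int \<Rightarrow> int) b < v a}"
  have s_i [simp]: "?s ?i = ?i + 1" "?s (?i + 1) = ?i"
    by (simp_all add: cox_gen_at cox_gen_succ)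
  have win: "inv_count n v = ?c v ?i + ?c v (?i + 1) + (\<Sum>a = ?i + 2..<?i + int n. ?c v a)"
    if v: "v \<in> affine_sym n" for v
  proof -
    have "inv_count n v = (\<Sum>a = ?i..<?i + int n. ?c v a)"
      unfolding inv_count_def
      using sum_periodic_window[of n "?c v" 0 ?i] card_inversions_shift[OF v] n3 by simp
    also have "{?i..<?i + int n} = insert ?i (insert (?i + 1) {?i + 2..<?i + int n})"
      using n3 by auto
    finally show ?thesis by simp
  qed
  \<comment> \<open>Reindexing the right ends moves the generator from the comparison of values to
    the comparison of positions, which \<open>gt\<close> then evaluates.\<close>
  have image: "card {b. P b} = card {b. P (?s b)}" for P
  proof -
    have "bij_betw ?s {b. P (?s b)} {b. P b}"
      by (rule bij_betw_byWitness[where f' = ?s]) auto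
    then show ?thesis by (simp add: bij_betw_same_card)
  qed
  have gt: "a < ?s b \<longleftrightarrow> (if b mod int n = ?i mod int n \<and> b = a then True
      else if (b - 1) mod int n = ?i mod int n \<and> b = a + 1 then False else a < b)" for a b
    using mod_add_small_neq[of 1 "b - 1"] n3 by (cases i b rule: cox_gen_cases) auto
  have "?c ?u a = ?c u a" if "a \<in> {?i + 2..<?i + int n}" for a
  proof -
    have ne: "a mod int n \<noteq> ?i mod int n" "(a - 1) mod int n \<noteq> ?i mod int n"
      using that mod_add_small_neq[of "a - ?i" ?i] mod_add_small_neq[of "a - 1 - ?i" ?i] by auto
    then have "?s a = a"
      by (rule cox_gen_other)
    then have "?c ?u a = card {b. a < ?s b \<and> u b < u a}"
      using image[of "\<lambda>b. a < b \<and> u (?s b) < u a"] by simp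
    also have "{b. a < ?s b \<and> u b < u a} = {b. a < b \<and> u b < u a}"
      using ne by (auto simp: gt split: if_splits)
    finally show ?thesis .
  qed
  moreover have "?c ?u ?i = ?c u (?i + 1) + 1"
  proof -
    have "?c ?u ?i = card {b. ?i < ?s b \<and> u b < u (?i + 1)}"
      using image[of "\<lambda>b. ?i < b \<and> u (?s b) < u (?i + 1)"] by simp
    also have "{b. ?i < ?s b \<and> u b < u (?i + 1)} = insert ?i {b. ?i + 1 < b \<and> u b < u (?i + 1)}"
    proof -
      have "?i < ?s b \<longleftrightarrow> b = ?i \<or> ?i + 1 < b" for b
        using mod_add_small_neq[of 1 ?i] n3
        by (cases "b = ?i + 1") (auto simp: gt)
      then show ?thesis using asc by auto
    qed
    finally show ?thesis
      using finite_inversions[OF u] by simp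
  qed
  moreover have "?c ?u (?i + 1) = ?c u ?i"
  proof -
    have "?c ?u (?i + 1) = card {b. ?i + 1 < ?s b \<and> u b < u ?i}"
      using image[of "\<lambda>b. ?i + 1 < b \<and> u (?s b) < u ?i"] by simp
    also have "{b. ?i + 1 < ?s b \<and> u b < u ?i} = {b. ?i < b \<and> u b < u ?i}"
    proof -
      have "?i + 1 < ?s b \<longleftrightarrow> ?i < b" if "u b < u ?i" for b
      proof -
        have "b \<noteq> ?i" "b \<noteq> ?i + 1" using asc that by auto
        moreover have "b = ?i + 2 \<Longrightarrow> (b - 1) mod int n \<noteq> ?i mod int n"
          using mod_add_small_neq[of 1 ?i] n3 by (auto simp: add.commute)
        ultimately show ?thesis by (auto simp: gt)
      qed
      then show ?thesis by auto
    qed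
    finally show ?thesis .
  qed
  ultimately show ?thesis
    using u by (simp add: win)
qed

lemma inv_count_descent:
  assumes u: "u \<in> affine_sym n" and desc: "u (int i) > u (int i + 1)"
  shows "inv_count n u = inv_count n (u \<circ> cox_gen n i) + 1"
proof -
  have "inv_count n ((u \<circ> cox_gen n i) \<circ> cox_gen n i) = inv_count n (u \<circ> cox_gen n i) + 1"
    by (rule inv_count_ascent)
       (use u desc in \<open>simp_all add: cox_gen_at cox_gen_succ\<close>)
  then show ?thesis by (simp add: comp_assoc)
qed

text \<open>An increasing bijection of the integers is a translation, and the normalised window sum
  forces the translation to be by 0.\<close>

lemma no_descent_imp_id:
  assumes u: "u \<in> affine_sym n" and asc: "\<And>i. i < n \<Longrightarrow> u (int i) < u (int i + 1)"
  shows "u = id"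
proof -
  have step: "u j < u (j + 1)" for j
  proof -
    have "u j = u (j mod int n) + (j - j mod int n)"
      "u (j + 1) = u (j mod int n + 1) + (j - j mod int n)"
      using affine_sym_mod[OF u, of j "j mod int n"]
        affine_sym_mod[OF u, of "j + 1" "j mod int n + 1"] by (simp_all add: mod_simps)
    moreover have "u (j mod int n) < u (j mod int n + 1)"
      using asc[of "nat (j mod int n)"] n3 by (simp add: nat_less_iff)
    ultimately show ?thesis by simp
  qed
  have mono: "u a < u b" if "a < b" for a b
    using that by (induction b rule: int_gr_induct) (auto intro: step less_trans)
  have succ: "u (j + 1) = u j + 1" for j
  proof -
    obtain k where k: "u k = u j + 1"
      using affine_sym_bij[OF u] by (metis bij_pointE)
    have "k = j + 1"
    proof (rule ccontr)
      assume "k \<noteq> j + 1"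
      then consider "k \<le> j" | "k > j + 1" by linarith
      then show False
        using mono[of k j] mono[of "j + 1" k] step[of j] k by cases (auto simp: order_le_less)
    qed
    then show ?thesis using k by simp
  qed
  have lin: "u j = u 0 + j" for j
  proof (induction j rule: int_induct[where k = 0])
    case (step2 j)
    then show ?case using succ[of "j - 1"] by simp
  qed (simp_all add: succ)
  have "(\<Sum>j = 1..int n. u 0 + j) = (\<Sum>j = 1..int n. j)"
    using u unfolding affine_sym_def by (simp add: lin[symmetric])
  then have "int n * u 0 = 0"
    by (simp add: sum.distrib)
  then have "u 0 = 0"
    using n3 by simp
  then show ?thesis
    using lin by (intro ext) (metis add_0 id_apply)
qed

text \<open>Sorting: each descent removed on the right costs one inversion and becomes the head
  letter, until no descent is left. The reversal appears because the head of \<open>\<rho>\<close>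
  is the rightmost factor of \<open>word_prod n (rev \<rho>)\<close>.\<close>

lemma affine_sym_word:
  assumes "u \<in> affine_sym n"
  shows "\<exists>\<rho> \<in> lists {..<n}. length \<rho> = inv_count n u \<and> word_prod n (rev \<rho>) = u"
  using assms
proof (induction "inv_count n u" arbitrary: u rule: less_induct)
  case less
  show ?case
  proof (cases "\<exists>i < n. u (int i) > u (int i + 1)")
    case False
    then have "u (int i) < u (int i + 1)" if "i < n" for i
      using that affine_sym_inj[OF less.prems, of "int i" "int i + 1"] by force
    then have "u = id"
      using no_descent_imp_id less.prems by blast
    moreover have "inv_count n id = 0"
      by (simp add: inv_count_def)
    ultimately show ?thesis by auto
  next
    case True
    then obtain i where i: "i < n" "u (int i) > u (int i + 1)" by auto
    note d = inv_count_descent[OF less.prems i(2)]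
    then obtain \<rho> where "\<rho> \<in> lists {..<n}" "length \<rho> = inv_count n (u \<circ> cox_gen n i)"
      "word_prod n (rev \<rho>) = u \<circ> cox_gen n i"
      using less.hyps[of "u \<circ> cox_gen n i"] less.prems by auto
    then show ?thesis
      using i d by (intro bexI[of _ "i # \<rho>"]) (auto simp: comp_assoc)
  qed
qed

lemma inv_count_comp_le:
  assumes "u \<in> affine_sym n"
  shows "inv_count n (u \<circ> cox_gen n i) \<le> inv_count n u + 1"
  using inv_count_ascent[OF assms, of i] inv_count_descent[OF assms, of i]
    affine_sym_inj[OF assms, of "int i" "int i + 1"]
  by (cases "u (int i)" "u (int i + 1)" rule: linorder_cases) auto

lemma inv_count_le_length: "inv_count n (word_prod n (rev \<rho>)) \<le> length \<rho>"
proof (induction \<rho>)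
  case (Cons i \<rho>)
  then show ?case
    using inv_count_comp_le[of "word_prod n (rev \<rho>)" i] by (simp del: o_apply)
qed (simp add: inv_count_def)

text \<open>Sorting the inverse yields a word of this length, and no word is shorter since each
  letter adds at most one inversion to the inverse.\<close>

lemma cox_length_eq_inv_count: "cox_length n (word_prod n \<rho>) = inv_count n (word_prod n (rev \<rho>))"
  unfolding cox_length_def
proof (rule Least_equality)
  show "\<exists>\<sigma> \<in> lists {..<n}. length \<sigma> = inv_count n (word_prod n (rev \<rho>)) \<and> word_prod n \<sigma> = word_prod n \<rho>"
    using affine_sym_word[of "word_prod n (rev \<rho>)"] by (auto simp: word_prod_rev_eq_iff)
next
  fix l
  assume "\<exists>\<sigma> \<in> lists {..<n}. length \<sigma> = l \<and> word_prod n \<sigma> = word_prod n \<rho>"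
  then obtain \<sigma> where "length \<sigma> = l" "word_prod n (rev \<sigma>) = word_prod n (rev \<rho>)"
    by (auto simp: word_prod_rev_eq_iff)
  then show "inv_count n (word_prod n (rev \<rho>)) \<le> l"
    using inv_count_le_length[of \<sigma>] by simp
qed

lemma reduced_word_iff:
  "reduced_word n w \<rho> \<longleftrightarrow>
     \<rho> \<in> lists {..<n} \<and> word_prod n \<rho> = w \<and> inv_count n (word_prod n (rev \<rho>)) = length \<rho>"
  using cox_length_eq_inv_count[of \<rho>] by (auto simp: reduced_word_def)

lemma reduced_word_exists: "w \<in> affine_sym n \<Longrightarrow> \<exists>\<rho>. reduced_word n w \<rho>"
proof -
  assume "w \<in> affine_sym n"
  then obtain \<rho> where "word_prod n \<rho> = w"
    using affine_sym_word by blast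
  moreover obtain \<sigma> where "\<sigma> \<in> lists {..<n}" "length \<sigma> = inv_count n (word_prod n (rev \<rho>))"
    "word_prod n (rev \<sigma>) = word_prod n (rev \<rho>)"
    using affine_sym_word[of "word_prod n (rev \<rho>)"] by auto
  ultimately have "reduced_word n w \<sigma>"
    using word_prod_rev_eq_iff[of \<sigma> \<rho>] by (simp add: reduced_word_iff)
  then show ?thesis ..
qed

definition is_reduced :: "nat list \<Rightarrow> bool" where
  "is_reduced \<rho> \<longleftrightarrow> reduced_word n (word_prod n \<rho>) \<rho>"

lemma reduced_word_iff_is_reduced: "reduced_word n w \<rho> \<longleftrightarrow> is_reduced \<rho> \<and> word_prod n \<rho> = w"
  by (auto simp: is_reduced_def reduced_word_def)

lemma is_reduced_Nil [simp]: "is_reduced []"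
  by (simp add: is_reduced_def reduced_word_iff inv_count_def)

text \<open>A letter changes the inversion number of the inverse by exactly one, and that number
  never exceeds the length. It can equal the longer length only when it already equalled the shorter
  one and has just gone up.\<close>

lemma is_reduced_Cons:
  "is_reduced (i # \<rho>) \<longleftrightarrow> i < n \<and> is_reduced \<rho> \<and>
     word_prod n (rev \<rho>) (int i) < word_prod n (rev \<rho>) (int i + 1)"
proof -
  let ?u = "word_prod n (rev \<rho>)"
  have u: "?u \<in> affine_sym n" by simp
  show ?thesis
    using inv_count_ascent[OF u, of i] inv_count_descent[OF u, of i] inv_count_le_length[of \<rho>]
      affine_sym_inj[OF u, of "int i" "int i + 1"]
    by (cases "?u (int i)" "?u (int i + 1)" rule: linorder_cases)
      (auto simp: is_reduced_def reduced_word_iff)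
qed

lemma is_reduced_suffix: "is_reduced (\<alpha> @ \<beta>) \<Longrightarrow> is_reduced \<beta>"
  by (induction \<alpha>) (auto simp: is_reduced_Cons)

section \<open>Patterns and braids\<close>

lemma descent_mod_obtain:
  assumes u: "u \<in> affine_sym n" and desc: "u k > u (k + 1)"
  obtains i where "i < n" "k mod int n = int i mod int n" "u (int i) > u (int i + 1)"
proof
  let ?i = "nat (k mod int n)"
  show "?i < n" using n3 by (simp add: nat_less_iff)
  show mod: "k mod int n = int ?i mod int n" using n3 by simp
  have "(k + 1) mod int n = (int ?i + 1) mod int n"
    using mod mod_succ_cancel by blast
  then show "u (int ?i) > u (int ?i + 1)"
    using affine_sym_mod[OF u mod] affine_sym_mod[OF u, of "k + 1" "int ?i + 1"] desc by simp
qed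

text \<open>The words described are reduced words of the inverse of \<open>u\<close>, so that
  removing a descent of \<open>u\<close> corresponds to removing a head letter.\<close>

definition has_braid_word :: "(int \<Rightarrow> int) \<Rightarrow> bool" where
  "has_braid_word u \<longleftrightarrow> (\<exists>xs i ys. let \<rho> = xs @ [i, (i + 1) mod n, i] @ ys in
     \<rho> \<in> lists {..<n} \<and> length \<rho> = inv_count n u \<and> word_prod n (rev \<rho>) = u)"

lemma has_braid_word_descent:
  assumes u: "u \<in> affine_sym n" and i: "i < n" and desc: "u (int i) > u (int i + 1)"
    and braid: "has_braid_word (u \<circ> cox_gen n i)"
  shows "has_braid_word u"
proof -
  obtain xs j ys where \<rho>: "xs @ [j, (j + 1) mod n, j] @ ys \<in> lists {..<n}"
    "length (xs @ [j, (j + 1) mod n, j] @ ys) = inv_count n (u \<circ> cox_gen n i)"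
    "word_prod n (rev (xs @ [j, (j + 1) mod n, j] @ ys)) = u \<circ> cox_gen n i"
    using braid unfolding has_braid_word_def Let_def by blast
  let ?\<rho> = "(i # xs) @ [j, (j + 1) mod n, j] @ ys"
  have "word_prod n (rev ?\<rho>) = word_prod n (rev (xs @ [j, (j + 1) mod n, j] @ ys)) \<circ> cox_gen n i"
    by (simp add: comp_assoc)
  also have "\<dots> = u"
    unfolding \<rho>(3) by (simp add: comp_assoc)
  finally have "word_prod n (rev ?\<rho>) = u" .
  moreover have "?\<rho> \<in> lists {..<n}" "length ?\<rho> = inv_count n u"
    using \<rho>(1,2) i inv_count_descent[OF u desc] by simp_all
  ultimately show ?thesis
    unfolding has_braid_word_def Let_def by blast
qed

text \<open>Three decreasing neighbours are reversed by the generators i, i+1, i, each step removing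
  a descent; any word that sorts the rest completes the factor to a reduced word.\<close>

lemma has_braid_word_consecutive:
  assumes u: "u \<in> affine_sym n" and desc: "u j > u (j + 1)" "u (j + 1) > u (j + 2)"
  shows "has_braid_word u"
proof -
  obtain i where i: "i < n" "j mod int n = int i mod int n" "u (int i) > u (int i + 1)"
    using descent_mod_obtain[OF u desc(1)] .
  define k where "k = (i + 1) mod n"
  have k: "k < n" using n3 by (simp add: k_def)
  have kmod: "int k mod int n = (int i + 1) mod int n"
    by (simp add: k_def of_nat_mod add.commute)
  have i2: "u (int i + 1) > u (int i + 2)"
  proof -
    have "(j + 1) mod int n = (int i + 1) mod int n" "(j + 2) mod int n = (int i + 2) mod int n"
      using i(2) by (simp_all add: mod_eq_dvd_iff)
    then show ?thesis
      using affine_sym_mod[OF u, of "j + 1" "int i + 1"] affine_sym_mod[OF u, of "j + 2" "int i + 2"]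
        desc(2) i(2) by simp
  qed
  have ne: "(int i + 1) mod int n \<noteq> int i mod int n" "(int i + 2) mod int n \<noteq> int i mod int n"
    using mod_add_small_neq[of 1 "int i"] mod_add_small_neq[of 2 "int i"] n3 by auto
  have s_i [simp]: "cox_gen n i (int i) = int i + 1" "cox_gen n i (int i + 1) = int i"
    "cox_gen n i (int i + 2) = int i + 2"
    using ne cox_gen_at[of "int i" i] cox_gen_succ[of "int i" i] cox_gen_other[of "int i + 2" i]
    by (simp_all add: add.commute)
  have gap: "(int i - 1) mod int n \<noteq> (int i + 1) mod int n"
    using mod_add_small_neq[of 2 "int i - 1"] n3 by (auto simp: add.commute)
  have s_k [simp]: "cox_gen n k (int i) = int i" "cox_gen n k (int i + 1) = int i + 2"
    "cox_gen n k (int i + 2) = int i + 1"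
  proof -
    show "cox_gen n k (int i) = int i"
      using ne gap kmod by (intro cox_gen_other) auto
    show "cox_gen n k (int i + 1) = int i + 2"
      using cox_gen_at[OF kmod[symmetric]] by (simp add: add.commute)
    show "cox_gen n k (int i + 2) = int i + 1"
      using cox_gen_succ[OF kmod[symmetric]] by (simp add: add.commute)
  qed
  \<comment> \<open>For \<open>i = n - 1\<close> the letter \<open>k\<close> is 0 and not
    \<open>i + 1\<close>, so the descent is carried over by translation.\<close>
  have at_k: "v (int k) > v (int k + 1)" if "v \<in> affine_sym n" "v (int i + 1) > v (int i + 2)" for v
  proof -
    have "(int k + 1) mod int n = (int i + 2) mod int n"
      using kmod mod_succ_cancel[of "int k" "int i + 1"] by (simp add: add.commute)
    then show ?thesis
      using affine_sym_mod[OF that(1) kmod] affine_sym_mod[OF that(1), of "int k + 1" "int i + 2"]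
        that(2) by (simp add: add.commute)
  qed
  let ?u1 = "u \<circ> cox_gen n i" let ?u2 = "?u1 \<circ> cox_gen n k" let ?u3 = "?u2 \<circ> cox_gen n i"
  have u1: "?u1 \<in> affine_sym n"
    using u by simp
  have "inv_count n u = inv_count n ?u1 + 1"
    using inv_count_descent[OF u i(3)] .
  moreover have "inv_count n ?u1 = inv_count n ?u2 + 1"
    by (rule inv_count_descent[OF u1 at_k[OF u1]]) (use i i2 in simp)
  moreover have "inv_count n ?u2 = inv_count n ?u3 + 1"
    by (rule inv_count_descent) (use u i2 in simp_all)
  moreover obtain \<rho> where \<rho>: "\<rho> \<in> lists {..<n}" "length \<rho> = inv_count n ?u3"
    "word_prod n (rev \<rho>) = ?u3"
    using affine_sym_word[of ?u3] u by auto
  moreover have "word_prod n (rev ([] @ [i, k, i] @ \<rho>)) = u"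
  proof -
    have "word_prod n (rev ([] @ [i, k, i] @ \<rho>))
        = word_prod n (rev \<rho>) \<circ> cox_gen n i \<circ> cox_gen n k \<circ> cox_gen n i"
      by (simp add: comp_assoc)
    also have "\<dots> = u"
      unfolding \<rho>(3) by (rule ext) simp
    finally show ?thesis .
  qed
  moreover have "length ([] @ [i, k, i] @ \<rho>) = length \<rho> + 3" "[] @ [i, k, i] @ \<rho> \<in> lists {..<n}"
    using \<rho> i k by auto
  ultimately show ?thesis
    unfolding has_braid_word_def Let_def
    by (intro exI[of _ "[]"] exI[of _ i] exI[of _ \<rho>]) (simp add: k_def)
qed

text \<open>A pattern that is not consecutive is moved together: either its outer entry can be replaced by
  one closer to the middle, or there is a descent whose removal preserves the pattern.\<close>

lemma pattern_321_imp_braid_word: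
  assumes "u \<in> affine_sym n" "a < b" "b < c" "u a > u b" "u b > u c"
  shows "has_braid_word u"
  using assms
proof (induction "inv_count n u + nat (c - a)" arbitrary: u a b c rule: less_induct)
  case less
  note u = less.prems(1)
  \<comment> \<open>Removing a descent lowers \<open>inv_count\<close>, the first summand of the
    measure; \<open>shrink\<close> keeps the width of the pattern from undoing this gain.\<close>
  have swap: "has_braid_word u" if desc: "u k > u (k + 1)"
    and ab: "\<not> (a mod int n = k mod int n \<and> b = a + 1)"
    and bc: "\<not> (b mod int n = k mod int n \<and> c = b + 1)"
    and shrink: "\<And>i. k mod int n = int i mod int n \<Longrightarrow> cox_gen n i c - cox_gen n i a \<le> c - a" for k
  proof -
    obtain i where i: "i < n" "k mod int n = int i mod int n" "u (int i) > u (int i + 1)"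
      using descent_mod_obtain[OF u desc] .
    let ?s = "cox_gen n i"
    have less': "?s a < ?s b" "?s b < ?s c"
      using ab bc i(2) less.prems(2,3) by (auto intro: cox_gen_less)
    have "inv_count n (u \<circ> ?s) + nat (?s c - ?s a) < inv_count n u + nat (c - a)"
      using inv_count_descent[OF u i(3)] shrink[OF i(2)] by auto
    then have "has_braid_word (u \<circ> ?s)"
      using less.hyps[of "u \<circ> ?s" "?s c" "?s a" "?s b"] less' less.prems by simp
    then show ?thesis
      using has_braid_word_descent[OF u i(1,3)] by blast
  qed
  have s_a: "cox_gen n i a \<ge> a - 1" "cox_gen n i c \<le> c + 1" for i
    by (cases i a rule: cox_gen_cases; simp) (cases i c rule: cox_gen_cases; simp)
  consider "c = b + 1" "b = a + 1" | "c > b + 1" "u (c - 1) < u b" | "c > b + 1" "u (c - 1) > u b"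
    | "b > a + 1" "u (a + 1) > u b" | "b > a + 1" "u (a + 1) < u b"
    using less.prems(2,3) affine_sym_inj[OF u, of "c - 1" b] affine_sym_inj[OF u, of "a + 1" b]
    by force
  then show ?case
  proof cases
    case 1
    then have "c = a + 2" by simp
    then show ?thesis
      using has_braid_word_consecutive[OF u, of a] less.prems(4,5) 1(2) by simp
  next
    case 2
    then show ?thesis
      using less.hyps[of u "c - 1" a b] less.prems by simp
  next
    case 3
    \<comment> \<open>\<open>c\<close> moves one step left, which pays for a possible left move of
      \<open>a\<close>.\<close>
    have "cox_gen n i c - cox_gen n i a \<le> c - a" if "(c - 1) mod int n = int i mod int n" for i
      using s_a[of i] cox_gen_succ[OF that] by simp
    \<comment> \<open>Otherwise \<open>b\<close> and \<open>c\<close> would be congruent, and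
      \<open>u\<close> keeps the order of congruent positions.\<close>
    moreover have "\<not> (a mod int n = (c - 1) mod int n \<and> b = a + 1)"
    proof
      assume "a mod int n = (c - 1) mod int n \<and> b = a + 1"
      then have "b mod int n = c mod int n"
        using mod_succ_cancel[of a "c - 1"] by simp
      then show False
        using affine_sym_mod[OF u, of b c] less.prems by simp
    qed
    ultimately show ?thesis
      using swap[of "c - 1"] 3 less.prems by simp
  next
    case 4
    then show ?thesis
      using less.hyps[of u c "a + 1" b] less.prems by simp
  next
    case 5
    have "cox_gen n i c - cox_gen n i a \<le> c - a" if "a mod int n = int i mod int n" for i
      using s_a[of i] cox_gen_at[OF that] by simp
    moreover have "\<not> (b mod int n = a mod int n \<and> c = b + 1)"
      using affine_sym_mod[OF u, of b a] less.prems by auto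
    ultimately show ?thesis
      using swap[of a] 5 less.prems by simp
  qed
qed

lemma avoids_321_no_pattern:
  assumes w: "w \<in> affine_sym n" and avoids: "avoids_321 n w"
    and "a < b" "b < c" "w a > w b" "w b > w c"
  shows False
proof -
  obtain \<sigma> where \<sigma>: "reduced_word n w \<sigma>"
    using reduced_word_exists[OF w] by blast
  let ?u = "word_prod n (rev \<sigma>)"
  have "word_prod n \<sigma> = w"
    using \<sigma> by (simp add: reduced_word_def)
  then have u_w: "?u (w x) = x" for x
    using word_prod_rev(2) by blast
  \<comment> \<open>Passing to the inverse turns the pattern around: the positions
    \<open>w c < w b < w a\<close> carry the values c, b, a.\<close>
  have "has_braid_word ?u"
    by (rule pattern_321_imp_braid_word[of _ "w c" "w b" "w a"]) (simp_all add: u_w assms)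
  then obtain xs i ys where \<rho>: "xs @ [i, (i + 1) mod n, i] @ ys \<in> lists {..<n}"
    "length (xs @ [i, (i + 1) mod n, i] @ ys) = inv_count n ?u"
    "word_prod n (rev (xs @ [i, (i + 1) mod n, i] @ ys)) = ?u"
    unfolding has_braid_word_def Let_def by blast
  then have "reduced_word n w (xs @ [i, (i + 1) mod n, i] @ ys)"
    using \<sigma> unfolding reduced_word_iff word_prod_rev_eq_iff
    by (metis word_prod_rev_eq_iff)
  with avoids show False
    unfolding avoids_321_def by blast
qed

section \<open>Legal words\<close>

text \<open>The words that do not annihilate a shape with edge sequence \<open>p\<close>.\<close>

fun legal :: "(int \<Rightarrow> nat) \<Rightarrow> nat list \<Rightarrow> bool" where
  "legal p [] \<longleftrightarrow> True"
| "legal p (i # \<rho>) \<longleftrightarrow> legal p \<rho> \<and>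
     p (word_prod n (rev \<rho>) (int i)) = 1 \<and> p (word_prod n (rev \<rho>) (int i + 1)) = 0"

lemma legal_append: "legal p (\<alpha> @ \<beta>) \<Longrightarrow> legal p \<beta>"
  by (induction \<alpha>) auto

text \<open>Reading letters modulo \<open>n\<close> lets the cyclic neighbour be written
  \<open>j - 1\<close> without a case for wrap-around; integer values allow differences.\<close>

definition letter_count :: "nat list \<Rightarrow> int \<Rightarrow> int" where
  "letter_count \<rho> j = int (count_list \<rho> (nat (j mod int n)))"

lemma letter_count_simps [simp]:
  "letter_count [] j = 0"
  "i < n \<Longrightarrow> letter_count (i # \<rho>) j = letter_count \<rho> j + (if j mod int n = int i then 1 else 0)"
  using n3 by (auto simp: letter_count_def)

lemma letter_count_append: "letter_count (\<alpha> @ \<beta>) j = letter_count \<alpha> j + letter_count \<beta> j"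
  by (simp add: letter_count_def)

lemma periodic_affine_sym:
  assumes per: "\<And>j. p (j + int n) = p j" and u: "u \<in> affine_sym n"
    and mod: "j mod int n = k mod int n"
  shows "p (u j) = p (u k)"
proof -
  obtain q where q: "j - k = int n * q"
    using mod by (auto simp: mod_eq_dvd_iff)
  have *: "p (x + int n * q) = p x" for x
  proof (induction q rule: int_induct[where k = 0])
    case (step1 q)
    then show ?case using per[of "x + int n * q"] by (simp add: algebra_simps)
  next
    case (step2 q)
    then show ?case using per[of "x + int n * (q - 1)"] by (simp add: algebra_simps)
  qed simp
  show ?thesis
    using affine_sym_mod[OF u mod] q *[of "u k"] by simp
qed

text \<open>A conservation law: each letter j carries a 1 away from position j to position j+1, so
  position j loses one per letter j and gains one per letter j-1.\<close>

lemma legal_letter_count: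
  assumes per: "\<And>j. p (j + int n) = p j" and "legal p \<rho>" "\<rho> \<in> lists {..<n}"
  shows "int (p (word_prod n (rev \<rho>) j)) = int (p j) - letter_count \<rho> j + letter_count \<rho> (j - 1)"
  using assms(2,3)
proof (induction \<rho> arbitrary: j)
  case (Cons i \<rho>)
  let ?u = "word_prod n (rev \<rho>)"
  have i: "i < n" and IH: "int (p (?u k)) = int (p k) - letter_count \<rho> k + letter_count \<rho> (k - 1)" for k
    using Cons by auto
  have pi: "p (?u (int i)) = 1" "p (?u (int i + 1)) = 0"
    using Cons.prems by auto
  have eq: "p (?u k) = p (?u l)" if "k mod int n = l mod int n" for k l
    using periodic_affine_sym[where p = p, OF per _ that] by simp
  have goal: "int (p (?u (cox_gen n i j))) = int (p (?u j)) - (if j mod int n = int i then 1 else 0)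
      + (if (j - 1) mod int n = int i then 1 else 0)"
  proof (cases i j rule: cox_gen_cases)
    case at
    moreover have "(j - 1) mod int n \<noteq> j mod int n"
      using mod_add_small_neq[of 1 "j - 1"] n3 by auto
    moreover have "(j + 1) mod int n = (int i + 1) mod int n"
      using at mod_succ_cancel by blast
    ultimately show ?thesis
      using pi eq[of j "int i"] eq[of "j + 1" "int i + 1"] i by auto
  next
    case succ
    moreover have "(j - 1) mod int n \<noteq> j mod int n"
      using mod_add_small_neq[of 1 "j - 1"] n3 by auto
    moreover have "j mod int n = (int i + 1) mod int n"
      using succ mod_succ_cancel[of "j - 1" "int i"] by simp
    ultimately show ?thesis
      using pi eq[of "j - 1" "int i"] eq[of j "int i + 1"] i by auto
  next
    case other
    then show ?thesis using i by simp
  qed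
  then show ?case
    using IH[of j] i by simp
qed simp

text \<open>Legality survives because the exchanged letters test only positions that the other
  generator fixes. The inverse products are tracked in the same induction since legality is tested
  on them.\<close>

lemma word_prod_commute:
  assumes "i < n" "\<alpha> \<in> lists {..<n}" and "letter_count \<alpha> (int i) = 0"
    "letter_count \<alpha> (int i - 1) = 0" "letter_count \<alpha> (int i + 1) = 0"
  shows "word_prod n (\<alpha> @ i # \<beta>) = word_prod n (i # \<alpha> @ \<beta>) \<and>
    word_prod n (rev (\<alpha> @ i # \<beta>)) = word_prod n (rev (i # \<alpha> @ \<beta>)) \<and>
    (legal p (\<alpha> @ i # \<beta>) \<longrightarrow> legal p (i # \<alpha> @ \<beta>))"
  using assms(2-)
proof (induction \<alpha>)
  case (Cons j \<alpha>)
  then have j: "j < n" by simp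
  have nonneg: "letter_count \<alpha> k \<ge> 0" for k
    by (simp add: letter_count_def)
  have ne: "int i mod int n \<noteq> int j" "(int i - 1) mod int n \<noteq> int j" "(int i + 1) mod int n \<noteq> int j"
    and zero: "letter_count \<alpha> (int i) = 0" "letter_count \<alpha> (int i - 1) = 0" "letter_count \<alpha> (int i + 1) = 0"
    using Cons.prems j nonneg[of "int i"] nonneg[of "int i - 1"] nonneg[of "int i + 1"]
    by (auto split: if_splits)
  have IH: "word_prod n (\<alpha> @ i # \<beta>) = word_prod n (i # \<alpha> @ \<beta>)"
    "word_prod n (rev (\<alpha> @ i # \<beta>)) = word_prod n (rev (i # \<alpha> @ \<beta>))"
    "legal p (\<alpha> @ i # \<beta>) \<Longrightarrow> legal p (i # \<alpha> @ \<beta>)"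
    using Cons zero by (auto simp del: o_apply)
  have far: "int i mod int n \<noteq> int j mod int n" "(int i + 1) mod int n \<noteq> int j mod int n"
    "(int j + 1) mod int n \<noteq> int i mod int n"
    using ne j mod_succ_cancel[of "int i - 1" "int j"] by auto
  have comm: "cox_gen n i \<circ> cox_gen n j = cox_gen n j \<circ> cox_gen n i"
    using far by (rule cox_gen_commute)
  let ?u = "word_prod n (rev (\<alpha> @ \<beta>))"
  have fixed: "cox_gen n i (int j) = int j" "cox_gen n i (int j + 1) = int j + 1"
    "cox_gen n j (int i) = int i" "cox_gen n j (int i + 1) = int i + 1"
    using far mod_succ_cancel[of "int i - 1" "int j"] mod_succ_cancel[of "int j - 1" "int i"]
    by (auto intro!: cox_gen_other)
  have "word_prod n ((j # \<alpha>) @ i # \<beta>) = cox_gen n j \<circ> word_prod n (i # \<alpha> @ \<beta>)"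
    using IH(1) by simp
  also have "\<dots> = word_prod n (i # (j # \<alpha>) @ \<beta>)"
    using comm by (simp add: comp_assoc[symmetric])
  finally have 1: "word_prod n ((j # \<alpha>) @ i # \<beta>) = word_prod n (i # (j # \<alpha>) @ \<beta>)" .
  have "word_prod n (rev ((j # \<alpha>) @ i # \<beta>)) = word_prod n (rev (i # \<alpha> @ \<beta>)) \<circ> cox_gen n j"
    using IH(2) by (simp add: comp_assoc[symmetric])
  also have "\<dots> = word_prod n (rev (i # (j # \<alpha>) @ \<beta>))"
    using comm by (simp add: comp_assoc)
  finally have 2: "word_prod n (rev ((j # \<alpha>) @ i # \<beta>)) = word_prod n (rev (i # (j # \<alpha>) @ \<beta>))" .
  have "legal p (i # (j # \<alpha>) @ \<beta>)" if "legal p ((j # \<alpha>) @ i # \<beta>)"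
  proof -
    have ij: "legal p (i # \<alpha> @ \<beta>)" "p (word_prod n (rev (i # \<alpha> @ \<beta>)) (int j)) = 1"
      "p (word_prod n (rev (i # \<alpha> @ \<beta>)) (int j + 1)) = 0"
      using that IH(2,3) by (simp_all del: rev.simps rev_append)
    then show ?thesis
      using fixed by simp
  qed
  with 1 2 show ?case by blast
qed simp

text \<open>A legal word is determined, up to commutations, by how often each letter occurs: its final
  state shows which letters can come last, and such a letter commutes past everything that is
  applied after its last occurrence.\<close>

lemma legal_mset_imp_word_prod_eq:
  assumes per: "\<And>j. p (j + int n) = p j"
    and "legal p \<rho>" "legal p \<sigma>" "\<rho> \<in> lists {..<n}" "mset \<rho> = mset \<sigma>"
  shows "word_prod n \<rho> = word_prod n \<sigma>"
  using assms(2-)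
proof (induction \<rho> arbitrary: \<sigma>)
  case (Cons i \<rho>)
  have i: "i < n" and \<rho>_n: "\<rho> \<in> lists {..<n}" using Cons.prems by auto
  have "i \<in> set \<sigma>"
    using Cons.prems(4) by (metis list.set_intros(1) set_mset_mset)
  \<comment> \<open>The first occurrence in the list is the last one to act.\<close>
  then obtain \<alpha> \<beta> where \<sigma>: "\<sigma> = \<alpha> @ i # \<beta>" "i \<notin> set \<alpha>"
    by (meson split_list_first)
  have \<sigma>_n: "\<sigma> \<in> lists {..<n}"
    using i \<rho>_n mset_eq_setD[OF Cons.prems(4), symmetric] by (simp add: lists_eq_set)
  then have \<alpha>_n: "\<alpha> \<in> lists {..<n}" and \<beta>_n: "i # \<beta> \<in> lists {..<n}"
    by (auto simp: \<sigma>)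
  have count: "letter_count (i # \<rho>) j = letter_count \<sigma> j" for j
    unfolding letter_count_def using Cons.prems(4) by (metis count_mset)
  have state: "int (p (word_prod n (rev \<sigma>) j)) = int (p (word_prod n (rev (i # \<rho>)) j))" for j
    using legal_letter_count[OF per Cons.prems(1,3), of j]
      legal_letter_count[OF per Cons.prems(2) \<sigma>_n, of j] count by simp
  have legal_\<beta>: "legal p (i # \<beta>)"
    using Cons.prems(2) \<sigma>(1) legal_append by blast
  have end_state: "p (word_prod n (rev (i # \<tau>)) (int i)) = 0" "p (word_prod n (rev (i # \<tau>)) (int i + 1)) = 1"
    if "legal p (i # \<tau>)" for \<tau>
    using that by (simp_all add: cox_gen_at cox_gen_succ)
  have diff: "int (p (word_prod n (rev \<sigma>) j)) =
      int (p (word_prod n (rev (i # \<beta>)) j)) - letter_count \<alpha> j + letter_count \<alpha> (j - 1)" for j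
    using legal_letter_count[OF per legal_\<beta> \<beta>_n, of j]
      legal_letter_count[OF per Cons.prems(2) \<sigma>_n, of j]
    unfolding \<sigma>(1) letter_count_append by linarith
  have zero: "letter_count \<alpha> (int i) = 0"
    using \<sigma>(2) i by (simp add: letter_count_def)
  \<comment> \<open>Right after this \<open>i\<close>, positions \<open>i\<close> and
    \<open>i + 1\<close> hold 0 and 1. They hold the same at the end, because the other word ends by
    applying \<open>i\<close>. As \<open>\<alpha>\<close> has no \<open>i\<close>, the conservation
    law leaves no room for either neighbour.\<close>
  have "letter_count \<alpha> (int i - 1) = 0" "letter_count \<alpha> (int i + 1) = 0"
    using diff[of "int i"] diff[of "int i + 1"] zero end_state[OF Cons.prems(1)]
      end_state[OF legal_\<beta>] state[of "int i"] state[of "int i + 1"]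
    by (simp_all del: rev.simps)
  note comm = word_prod_commute[OF i \<alpha>_n zero this, of \<beta> p]
  have "legal p (i # \<alpha> @ \<beta>)"
    using comm Cons.prems(2) unfolding \<sigma>(1) by blast
  then have "legal p (\<alpha> @ \<beta>)" by simp
  moreover have "mset \<rho> = mset (\<alpha> @ \<beta>)"
    using Cons.prems(4) by (simp add: \<sigma>(1))
  ultimately have "word_prod n \<rho> = word_prod n (\<alpha> @ \<beta>)"
    using Cons.IH \<rho>_n Cons.prems(1) by simp
  then show ?case
    using comm by (simp add: \<sigma>(1))
qed simp

section \<open>Letter multiplicities recovered from end states\<close>

text \<open>With equal end states the conservation law equates the difference of multiplicities at
  neighbouring letters, so a single constant remains undetermined.\<close>

lemma legal_letter_count_diff:
  assumes per: "\<And>j. p (j + int n) = p j"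
    and "legal p \<rho>" "legal p \<sigma>" "\<rho> \<in> lists {..<n}" "\<sigma> \<in> lists {..<n}"
    and eq: "\<And>j. p (word_prod n (rev \<rho>) j) = p (word_prod n (rev \<sigma>) j)"
  shows "letter_count \<rho> (int j) - letter_count \<sigma> (int j) = letter_count \<rho> 0 - letter_count \<sigma> 0"
proof (induction j)
  case (Suc j)
  then show ?case
    using legal_letter_count[OF per assms(2,4), of "int (Suc j)"]
      legal_letter_count[OF per assms(3,5), of "int (Suc j)"] eq[of "int (Suc j)"] by simp
qed simp

lemma length_eq_sum_letter_count:
  assumes "\<rho> \<in> lists {..<n}"
  shows "int (length \<rho>) = (\<Sum>j<n. letter_count \<rho> (int j))"
proof -
  have "(\<Sum>j<n. letter_count \<rho> (int j)) = int (\<Sum>j<n. count_list \<rho> j)"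
    by (simp add: letter_count_def)
  also have "(\<Sum>j<n. count_list \<rho> j) = (\<Sum>j\<in>set \<rho>. count_list \<rho> j)"
    using assms by (intro sum.mono_neutral_right) (auto simp: lists_eq_set)
  also have "\<dots> = length \<rho>"
    by (simp add: sum_count_set)
  finally show ?thesis by simp
qed

lemma legal_mset_eq:
  assumes per: "\<And>j. p (j + int n) = p j"
    and "legal p \<rho>" "legal p \<sigma>" "\<rho> \<in> lists {..<n}" "\<sigma> \<in> lists {..<n}"
    and "\<And>j. p (word_prod n (rev \<rho>) j) = p (word_prod n (rev \<sigma>) j)"
    and zero: "count_list \<rho> 0 = count_list \<sigma> 0"
  shows "mset \<rho> = mset \<sigma>"
proof (rule multiset_eqI)
  fix i
  show "count (mset \<rho>) i = count (mset \<sigma>) i"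
  proof (cases "i < n")
    case True
    then have "int (count_list \<rho> i) = int (count_list \<sigma> i)"
      using legal_letter_count_diff[OF assms(1-6), of i] zero by (simp add: letter_count_def)
    then show ?thesis by (simp add: count_mset)
  next
    case False
    then have "i \<notin> set \<rho>" "i \<notin> set \<sigma>" using assms(4,5) by auto
    then show ?thesis by (simp add: count_mset)
  qed
qed

text \<open>The multiplicities add up to the length, so \<open>n\<close> times the constant is the
  difference of the lengths.\<close>

lemma legal_zero_count_eq:
  assumes per: "\<And>j. p (j + int n) = p j"
    and "legal p \<rho>" "legal p \<sigma>" "\<rho> \<in> lists {..<n}" "\<sigma> \<in> lists {..<n}"
    and "\<And>j. p (word_prod n (rev \<rho>) j) = p (word_prod n (rev \<sigma>) j)"
    and len: "length \<rho> = length \<sigma>"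
  shows "count_list \<rho> 0 = count_list \<sigma> 0"
proof -
  have "(\<Sum>j<n. letter_count \<rho> (int j) - letter_count \<sigma> (int j)) = 0"
    using len length_eq_sum_letter_count[OF assms(4)] length_eq_sum_letter_count[OF assms(5)]
    by (simp add: sum_subtractf)
  then have "int n * (letter_count \<rho> 0 - letter_count \<sigma> 0) = 0"
    by (simp add: legal_letter_count_diff[OF assms(1-6)])
  then show ?thesis
    using n3 by (simp add: letter_count_def)
qed

section \<open>Inversions along reduced words and the starting sequence\<close>

text \<open>A letter \<open>i\<close> could undo the inversion only by exchanging the two values
  when they are adjacent. The ascent that reducedness demands of the inverse at \<open>i\<close>
  would then say \<open>b < a\<close>.\<close>

lemma inversion_persists:
  assumes "is_reduced (\<alpha> @ \<gamma>)" and "a < b" "word_prod n \<gamma> a > word_prod n \<gamma> b"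
  shows "word_prod n (\<alpha> @ \<gamma>) a > word_prod n (\<alpha> @ \<gamma>) b"
  using assms(1)
proof (induction \<alpha>)
  case Nil
  then show ?case using assms(3) by simp
next
  case (Cons i \<alpha>)
  let ?v = "word_prod n (\<alpha> @ \<gamma>)" and ?u = "word_prod n (rev (\<alpha> @ \<gamma>))"
  have red: "is_reduced (\<alpha> @ \<gamma>)" "?u (int i) < ?u (int i + 1)"
    using Cons.prems by (simp_all add: is_reduced_Cons)
  then have less: "?v b < ?v a" using Cons.IH by blast
  have "\<not> (?v b mod int n = int i mod int n \<and> ?v a = ?v b + 1)"
  proof
    assume *: "?v b mod int n = int i mod int n \<and> ?v a = ?v b + 1"
    then have "?v a mod int n = (int i + 1) mod int n"
      using mod_succ_cancel by metis
    then have "?u (?v b) = ?u (int i) + (?v b - int i)" "?u (?v a) = ?u (int i + 1) + (?v a - (int i + 1))"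
      using * affine_sym_mod[OF word_prod_affine_sym] by blast+
    then have "b < a"
      using red(2) * unfolding word_prod_rev(2) by linarith
    with \<open>a < b\<close> show False by simp
  qed
  with less have "cox_gen n i (?v b) < cox_gen n i (?v a)"
    by (rule cox_gen_less)
  then show ?case by simp
qed

lemma inversion_start_periodic:
  assumes w: "w \<in> affine_sym n"
  shows "inversion_start w (a + int n) = inversion_start w a"
proof -
  have "(\<exists>b > a + int n. w b < w (a + int n)) \<longleftrightarrow> (\<exists>b > a. w b < w a)"
  proof
    assume "\<exists>b > a + int n. w b < w (a + int n)"
    then obtain b where "b > a + int n" "w b < w (a + int n)" by blast
    then have "b - int n > a \<and> w (b - int n) < w a"
      using affine_sym_shift[OF w, of "b - int n"] affine_sym_shift[OF w, of a] by simp
    then show "\<exists>b > a. w b < w a" by blast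
  next
    assume "\<exists>b > a. w b < w a"
    then obtain b where "b > a" "w b < w a" by blast
    then have "b + int n > a + int n \<and> w (b + int n) < w (a + int n)"
      using affine_sym_shift[OF w] by simp
    then show "\<exists>b > a + int n. w b < w (a + int n)" by blast
  qed
  then show ?thesis by (simp add: inversion_start_def)
qed

text \<open>When a reduced word creates an inversion, its two entries form an inversion of \<open>w\<close>;
  without a 321 pattern the larger one is not also the smaller one of another inversion.\<close>

lemma reduced_word_legal:
  assumes w: "w \<in> affine_sym n" and avoids: "avoids_321 n w" and red: "reduced_word n w (\<alpha> @ \<rho>)"
  shows "legal (inversion_start w) \<rho>"
  using red
proof (induction \<rho> arbitrary: \<alpha>)
  case (Cons i \<rho>)
  let ?u = "word_prod n (rev \<rho>)"
  have red: "is_reduced (\<alpha> @ i # \<rho>)" and w_eq: "w = word_prod n (\<alpha> @ i # \<rho>)"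
    using Cons.prems by (simp_all add: reduced_word_iff_is_reduced)
  have asc: "?u (int i) < ?u (int i + 1)"
    using is_reduced_suffix[OF red] by (simp add: is_reduced_Cons)
  have inv: "w (?u (int i + 1)) < w (?u (int i))"
    unfolding w_eq using red asc
    by (rule inversion_persists) (simp add: cox_gen_at cox_gen_succ)
  \<comment> \<open>The letter moves into the prefix: an inversion created by a suffix must be
    followed to the end of a full reduced word of \<open>w\<close>.\<close>
  have "legal (inversion_start w) \<rho>"
    using Cons.IH[of "\<alpha> @ [i]"] Cons.prems by simp
  moreover have "inversion_start w (?u (int i)) = 1"
    using asc inv by (auto simp: inversion_start_def)
  moreover have "inversion_start w (?u (int i + 1)) = 0"
    using avoids_321_no_pattern[OF w avoids asc _ inv] by (auto simp: inversion_start_def)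
  ultimately show ?case by simp
qed simp

text \<open>Any one reduced word \<open>\<sigma>\<close> supplies the target state. Conversely, a
  legal word with that target has the letters of \<open>\<sigma>\<close>, hence both its product and
  its length.\<close>

lemma reduced_word_iff_legal:
  fixes \<sigma> :: "nat list"
  assumes w: "w \<in> affine_sym n" and avoids: "avoids_321 n w" and \<sigma>: "reduced_word n w \<sigma>"
    and \<rho>: "\<rho> \<in> lists {..<n}"
  defines "p \<equiv> inversion_start w"
  shows "reduced_word n w \<rho> \<longleftrightarrow> legal p \<rho> \<and>
    p \<circ> word_prod n (rev \<rho>) = p \<circ> word_prod n (rev \<sigma>) \<and> count_list \<rho> 0 = count_list \<sigma> 0"
proof
  note per = inversion_start_periodic[OF w, folded p_def]
  have legal_red: "legal p \<tau>" if "reduced_word n w \<tau>" for \<tau>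
    using reduced_word_legal[OF w avoids, of "[]"] that by (simp add: p_def)
  have \<sigma>_n: "\<sigma> \<in> lists {..<n}" using \<sigma> by (simp add: reduced_word_def)
  {
    assume red: "reduced_word n w \<rho>"
    then have "word_prod n (rev \<rho>) = word_prod n (rev \<sigma>)"
      using \<sigma> by (simp add: word_prod_rev_eq_iff reduced_word_def)
    moreover have "length \<rho> = length \<sigma>"
      using red \<sigma> by (simp add: reduced_word_def)
    ultimately show "legal p \<rho> \<and> p \<circ> word_prod n (rev \<rho>) = p \<circ> word_prod n (rev \<sigma>) \<and>
        count_list \<rho> 0 = count_list \<sigma> 0"
      using legal_zero_count_eq[OF per legal_red[OF red] legal_red[OF \<sigma>] \<rho> \<sigma>_n] legal_red[OF red]
      by simp
  }
  assume *: "legal p \<rho> \<and> p \<circ> word_prod n (rev \<rho>) = p \<circ> word_prod n (rev \<sigma>) \<and>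
    count_list \<rho> 0 = count_list \<sigma> 0"
  then have mset: "mset \<rho> = mset \<sigma>"
    using legal_mset_eq[OF per _ legal_red[OF \<sigma>] \<rho> \<sigma>_n] by (simp add: fun_eq_iff)
  then have "word_prod n \<rho> = word_prod n \<sigma>"
    using legal_mset_imp_word_prod_eq[OF per _ legal_red[OF \<sigma>] \<rho>] * by blast
  then show "reduced_word n w \<rho>"
    using \<sigma> \<rho> mset_eq_length[OF mset] by (simp add: reduced_word_def)
qed

section \<open>The coefficients as sums over words\<close>

lemma word_op_affine_act:
  assumes "\<rho> \<in> lists {..<n}"
  shows "word_op (affine_act n) \<rho> (basis_vec id) =
    (if is_reduced \<rho> then basis_vec (word_prod n \<rho>) else 0)"
  using assms
proof (induction \<rho>)
  case (Cons i \<rho>)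
  then have i: "i < n" by simp
  have "affine_act n i (word_prod n \<rho>) = (if is_reduced (i # \<rho>) then basis_vec (word_prod n (i # \<rho>)) else 0)"
    if red: "is_reduced \<rho>"
  proof -
    have "cox_length n (word_prod n \<rho>) = length \<rho>"
      using red by (simp add: is_reduced_def reduced_word_def)
    \<comment> \<open>The length of the product is at most the number of letters, so exceeding
      \<open>length \<rho>\<close> means attaining it.\<close>
    moreover have "is_reduced (i # \<rho>) \<longleftrightarrow> cox_length n (word_prod n (i # \<rho>)) > length \<rho>"
      using red i Cons.prems inv_count_le_length[of "i # \<rho>"]
        cox_length_eq_inv_count[of "i # \<rho>"]
      by (auto simp: is_reduced_def reduced_word_def simp del: word_prod_simps rev.simps)
    ultimately show ?thesis
      by (simp add: affine_act_def)
  qed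
  moreover have "word_op (affine_act n) \<rho> (basis_vec id) =
      (if is_reduced \<rho> then basis_vec (word_prod n \<rho>) else 0)"
    by (rule Cons.IH)
  ultimately have "word_op (affine_act n) (i # \<rho>) (basis_vec id) =
      (if is_reduced (i # \<rho>) then basis_vec (word_prod n (i # \<rho>)) else 0)"
    using is_reduced_Cons[of i \<rho>] by auto
  then show ?case .
qed (simp del: id_apply)

lemma word_op_cyl_act:
  "word_op (cyl_act n) \<rho> (basis_vec (p, r)) =
    (if legal p \<rho> then basis_vec (p \<circ> word_prod n (rev \<rho>), r + int (count_list \<rho> 0)) else 0)"
proof (induction \<rho>)
  case (Cons i \<rho>)
  have "word_op (cyl_act n) (i # \<rho>) (basis_vec (p, r)) =
      (if legal p (i # \<rho>) then basis_vec (p \<circ> word_prod n (rev \<rho>) \<circ> cox_gen n i,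
        r + int (count_list (i # \<rho>) 0)) else 0)"
  proof -
    have "cyl_act n i (q, t) = (if q (int i) = 1 \<and> q (int i + 1) = 0
        then basis_vec (q \<circ> cox_gen n i, if i = 0 then t + 1 else t) else 0)" for q t
      by (simp add: cyl_act_def)
    then show ?thesis by (simp add: Cons.IH add_ac)
  qed
  then show ?case by (simp add: comp_assoc del: o_apply)
qed simp

section \<open>Letters of the words in the expansion\<close>

text \<open>A residue \<open>c\<close> outside \<open>A\<close> cuts the circle open, and the rest
  is listed downwards from c-1 to c+1. Existence gives the word chosen by \<open>SOME\<close> the
  letter set \<open>A\<close>.\<close>

lemma cyc_decreasing_word_exists:
  assumes "A \<subset> {..<n}"
  shows "\<exists>\<rho>. cyc_decreasing_word n A \<rho>"
proof -
  obtain c where c: "c < n" "c \<notin> A" and A: "A \<subseteq> {..<n}"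
    using assms by auto
  let ?f = "\<lambda>k. (c + k) mod n"
  have f_inj: "inj_on ?f {..<n}"
  proof (rule inj_onI)
    fix k l
    assume kl: "k \<in> {..<n}" "l \<in> {..<n}" "?f k = ?f l"
    then have "int n dvd int k - int l"
      using mod_eq_dvd_iff[of "int (c + k)" "int n" "int (c + l)"]
      by (metis add_diff_cancel_left of_nat_add of_nat_mod)
    with kl show "k = l"
      using zdvd_imp_le[of "int n" "int k - int l"] zdvd_imp_le[of "int n" "int l - int k"]
      by (cases k l rule: linorder_cases) (auto simp: dvd_diff_commute)
  qed
  have f_surj: "\<exists>k \<in> {1..<n}. a = ?f k" if "a \<in> A" for a
  proof -
    have "a < n" "a \<noteq> c" using that A c by auto
    then show ?thesis
      using c by (intro bexI[of _ "if a > c then a - c else a + n - c"]) auto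
  qed
  let ?\<rho> = "filter (\<lambda>a. a \<in> A) (map ?f (rev [1..<n]))"
  have "inj_on ?f {1..<n}"
    by (rule inj_on_subset[OF f_inj]) auto
  then have "distinct ?\<rho>"
    by (intro distinct_filter) (simp add: distinct_map)
  moreover have "set ?\<rho> = A"
    using f_surj by auto
  moreover have "\<exists>xs ys zs. ?\<rho> = xs @ [(i + 1) mod n] @ ys @ [i] @ zs"
    if i: "i \<in> A" and i': "(i + 1) mod n \<in> A" for i
  proof -
    obtain k where k: "1 \<le> k" "k < n" "i = ?f k"
      using f_surj[OF i] by auto
    have succ: "(i + 1) mod n = ?f (k + 1)"
      by (simp add: k(3) mod_simps)
    \<comment> \<open>A successor pair across the cut would have \<open>c\<close> as its upper
      member, but \<open>c\<close> is not in \<open>A\<close>.\<close>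
    have "k + 1 \<noteq> n"
    proof
      assume "k + 1 = n"
      then have "?f (k + 1) = c"
        by (simp only: mod_add_self2 mod_less c(1))
      with succ i' c(2) show False by simp
    qed
    then have "[1..<n] = [1..<k] @ [k, k + 1] @ [k + 2..<n]"
      using k upt_add_eq_append[of 1 k "n - k"] by (simp add: upt_conv_Cons)
    then have "?\<rho> = filter (\<lambda>a. a \<in> A) (map ?f (rev [k + 2..<n])) @ [(i + 1) mod n] @ [] @ [i] @
        filter (\<lambda>a. a \<in> A) (map ?f (rev [1..<k]))"
      using i i' k(3) succ by simp
    then show ?thesis by blast
  qed
  ultimately show ?thesis
    unfolding cyc_decreasing_word_def by blast
qed

lemma set_cyc_word:
  assumes "A \<subset> {..<n}"
  shows "set (SOME \<rho>. cyc_decreasing_word n A \<rho>) = A"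
  using someI_ex[OF cyc_decreasing_word_exists[OF assms]] by (simp add: cyc_decreasing_word_def)

lemma h_words_letters: "\<rho> \<in># h_words n ks \<Longrightarrow> \<rho> \<in> lists {..<n}"
proof (induction ks arbitrary: \<rho>)
  case (Cons k ks)
  have "finite {A. A \<subset> {..<n} \<and> card A = k}"
    by (rule finite_subset[of _ "Pow {..<n}"]) auto
  with Cons.prems obtain A \<sigma> where "A \<subset> {..<n}" "\<sigma> \<in># h_words n ks"
    "\<rho> = \<sigma> @ (SOME \<rho>. cyc_decreasing_word n A \<rho>)"
    by (auto simp: set_mset_sum)
  then show ?case
    using Cons.IH set_cyc_word by (auto simp: lists_eq_set)
qed simp

lemma sum_word_prod_periodic:
  fixes p :: "int \<Rightarrow> nat"
  assumes per: "\<And>j. p (j + int n) = p j"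
  shows "(\<Sum>j = 1..int n. p (word_prod n (rev \<rho>) j)) = (\<Sum>j = 1..int n. p j)"
proof (induction \<rho>)
  case (Cons i \<rho>)
  have W: "{1..int n} = {1..<1 + int n}" by auto
  have "(\<Sum>j = 1..int n. p (word_prod n (rev \<rho>) (cox_gen n i j)))
      = (\<Sum>j = 1..int n. p (word_prod n (rev \<rho>) j))"
    unfolding W
    by (rule sum_cox_gen[where f = "\<lambda>j. p (word_prod n (rev \<rho>) j)"])
      (simp add: affine_sym_shift per)
  then show ?case using Cons by simp
qed simp

lemma affine_stanley_eq_cyl_schur:
  assumes w: "w \<in> affine_sym n" and avoids: "avoids_321 n w" and \<sigma>: "reduced_word n w \<sigma>"
  defines "p \<equiv> inversion_start w"
  shows "affine_stanley n w = cyl_schur n (p \<circ> word_prod n (rev \<sigma>), int (count_list \<sigma> 0)) (p, 0)"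
proof
  fix a
  show "affine_stanley n w a = cyl_schur n (p \<circ> word_prod n (rev \<sigma>), int (count_list \<sigma> 0)) (p, 0) a"
    unfolding affine_stanley_def cyl_schur_def h_series_eq_sum_words
  proof (rule arg_cong[where f = sum_mset], rule image_mset_cong)
    fix \<rho>
    assume "\<rho> \<in># h_words n (map (Poly_Mapping.lookup a) [0..<Poly_Mapping.degree a])"
    then have \<rho>: "\<rho> \<in> lists {..<n}"
      by (rule h_words_letters)
    note iff = reduced_word_iff_legal[OF w avoids \<sigma> \<rho>, folded p_def, unfolded reduced_word_iff_is_reduced]
    \<comment> \<open>Each word contributes 0 or 1 to either side, and 1 exactly when it is a
      reduced word of \<open>w\<close>.\<close>
    show "Poly_Mapping.lookup (word_op (affine_act n) \<rho> (basis_vec id)) w =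
        Poly_Mapping.lookup (word_op (cyl_act n) \<rho> (basis_vec (p, 0)))
          (p \<circ> word_prod n (rev \<sigma>), int (count_list \<sigma> 0))"
      unfolding word_op_affine_act[OF \<rho>] word_op_cyl_act
      using iff by (auto simp: lookup_basis_vec)
  qed
qed

end

theorem theorem16p3:
  fixes n :: nat and w :: "int \<Rightarrow> int"
  assumes "n \<ge> 3"
    and "w \<in> affine_sym n"
    and "avoids_321 n w"
  shows "\<exists>m \<le> n. \<exists>\<mu> \<in> cyl_shapes n m. \<exists>\<kappa> \<in> cyl_shapes n m.
           u_elt n (cyl_act n) w (basis_vec \<mu>) = basis_vec \<kappa> \<and>
           affine_stanley n w = cyl_schur n \<kappa> \<mu>"
proof -
  define p where "p = inversion_start w"
  \<comment> \<open>The same choice as in \<open>u_elt\<close>, so that the operator is evaluated on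
    \<open>\<sigma>\<close> itself.\<close>
  define \<sigma> where "\<sigma> = (SOME \<rho>. reduced_word n w \<rho>)"
  define m where "m = (\<Sum>j = 1..int n. p j)"
  let ?\<mu> = "(p, 0) :: cyl_shape"
  let ?\<kappa> = "(p \<circ> word_prod n (rev \<sigma>), int (count_list \<sigma> 0)) :: cyl_shape"
  have \<sigma>: "reduced_word n w \<sigma>"
    unfolding \<sigma>_def using someI_ex[OF reduced_word_exists[OF assms(1,2)]] .
  have per: "p (j + int n) = p j" for j
    unfolding p_def by (rule inversion_start_periodic[OF assms(1,2)])
  have p01: "p j \<in> {0, 1}" for j
    by (simp add: p_def inversion_start_def)
  have "m \<le> n"
  proof -
    have "m \<le> (\<Sum>j = 1..int n. 1)"
      unfolding m_def using p01 by (intro sum_mono) (metis insert_iff le_numeral_extra(4) singletonD zero_le)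
    then show ?thesis by simp
  qed
  moreover have "?\<mu> \<in> cyl_shapes n m"
    using per p01 by (simp add: cyl_shapes_def edge_seqs_def m_def)
  moreover have "?\<kappa> \<in> cyl_shapes n m"
    using per p01 sum_word_prod_periodic[OF assms(1), of p \<sigma>]
      affine_sym_shift[OF assms(1) word_prod_affine_sym[OF assms(1)]]
    by (simp add: cyl_shapes_def edge_seqs_def m_def)
  moreover have "u_elt n (cyl_act n) w (basis_vec ?\<mu>) = basis_vec ?\<kappa>"
  proof -
    have "legal n p \<sigma>"
      using reduced_word_legal[OF assms, of "[]"] \<sigma> by (simp add: p_def)
    then show ?thesis
      unfolding u_elt_def \<sigma>_def[symmetric] by (simp add: word_op_cyl_act[OF assms(1)])
  qed
  moreover have "affine_stanley n w = cyl_schur n ?\<kappa> ?\<mu>"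
    unfolding p_def using affine_stanley_eq_cyl_schur[OF assms \<sigma>] .
  ultimately show ?thesis by blast
qed

end
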